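(* Let $G$ be a fixed finite simple graph. Each of the following graph families $\mathscr{G}=\{\mathscr{G}_n\}$ is rational, i.e. its generating function $\Xi_{\mathscr G}(x)=\sum_{n}\sum_{K\in\mathscr G_n}W_K(t)\,x^n$ is a rational function of $x$ with coefficients in $\mathbb{Z}[t]$ (there exist $P,Q\in\mathbb{Z}[t][x]$ with $Q$ having nonzero constant term such that $Q\,\Xi_{\mathscr G}=P$): (GC) $\mathscr G_n=\{G\times P_n\}$, $n\ge 1$ (the $G$-cylinders); (GX) for a fixed subgraph $H\subseteq G$, $\mathscr G_n=\{X_n(G,H)\}$, $n\ge1$, where $X_n(G,H)$ is obtained from the disjoint union $G\sqcup (H\times P_n)$ by identifying $H\subseteq G$ with $H\times\{1\}$ (extrusions); (GT) $\mathscr G_n=\{G\times C_n\}$, $n\ge3$ (the $G$-tori); (GE) for a fixed subgraph $H\subseteq G$, $\mathscr G_n=\{E_n(G,H)\}$, $n\ge 3$, where $E_n(G,H)$ is obtained from $G\sqcup (H\times C_n)$ by identifying $H\subseteq G$ with $H\times\{1\}$ (earrings); (GS1) for a fixed edge $e$ of $G$, $\mathscr G_n=\{S_n(G,e)\}$, $n\ge 0$, where $S_n(G,e)$ is obtained from $G$ by subdividing $e$ with $n$ new vertices; (GSm) for a fixed set of edges $F=\{e_1,\dots,e_m\}\subseteq E(G)$, $\mathscr G_n$ consists of the graphs obtained from $G$ by subdividing each $e_k$ with $n_k\ge0$ new vertices, one graph for each tuple $(n_1,\dots,n_m)$ of nonnegative integers with $n_1+\dots+n_m=n$ (counted with mu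ltiplicity).
   Context: All graphs are finite and simple. A coloring of a graph $K$ is a map $c\colon V(K)\to\{0,1\}$ ($0$ = white, $1$ = black). For a coloring $c$, call a vertex $v$ even-white if $c(v)=0$ and $v$ has an even number of black neighbors. The black-white polynomial is $W_K(t)=\sum_{c} t^{\#\{\text{even-white vertices of }c\}}\in\mathbb{Z}[t]$, the sum over all $2^{|V(K)|}$ colorings; $W_\emptyset=1$. $P_n$ is the path graph on $n$ vertices $\{1,\dots,n\}$ and $C_n$ the cycle graph on $n$ vertices $\{1,\dots,n\}$. For graphs $K,K'$, the product $K\times K'$ is the Cartesian (box) product: vertex set $V(K)\times V(K')$, with $(u,u')$ adjacent to $(v,v')$ iff either $u'=v'$ and $u$ is adjacent to $v$ in $K$, or $u=v$ and $u'$ is adjacent to $v'$ in $K'$ (so $P_2\times P_2\cong C_4$). *)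

theory Defs
  imports "HOL-Library.FuncSet" "HOL-Library.Multiset"
    "HOL-Computational_Algebra.Polynomial_FPS"
begin

record 'a graph =
  verts :: "'a set"
  edges :: "'a set set"

definition simple_graph :: "'a graph \<Rightarrow> bool" where
  "simple_graph G \<longleftrightarrow>
     finite (verts G) \<and> (\<forall>e\<in>edges G. e \<subseteq> verts G \<and> card e = 2)"

definition adj :: "'a graph \<Rightarrow> 'a \<Rightarrow> 'a \<Rightarrow> bool" where
  "adj G u v \<longleftrightarrow> {u, v} \<in> edges G"

text \<open>Subgraphs are not required to be induced or spanning, and may be empty.\<close>

definition subgraph :: "'a graph \<Rightarrow> 'a graph \<Rightarrow> bool" where
  "subgraph H G \<longleftrightarrow> simple_graph H \<and> verts H \<subseteq> verts G \<and> edges H \<subseteq> edges G"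


subsection \<open>The black-white polynomial\<close>

text \<open>Colorings are extensional functions, so that there are exactly
  \<open>2 ^ card (verts K)\<close> of them; 0 is white and 1 is black.\<close>

definition colorings :: "'a graph \<Rightarrow> ('a \<Rightarrow> nat) set" where
  "colorings K = verts K \<rightarrow>\<^sub>E {0, 1}"

definition even_white :: "'a graph \<Rightarrow> ('a \<Rightarrow> nat) \<Rightarrow> 'a set" where
  "even_white K c =
     {v \<in> verts K. c v = 0 \<and> even (card {u \<in> verts K. adj K v u \<and> c u = 1})}"

definition bw_poly :: "'a graph \<Rightarrow> int poly" where
  "bw_poly K = (\<Sum>c\<in>colorings K. monom 1 (card (even_white K c)))"


subsection \<open>Graph families and rationality\<close>

text \<open>The \<open>n\<close>-th member of a family is a finite multiset of graphs. In an
  \<open>int poly poly\<close> the outer variable is \<open>x\<close> and the inner one is \<open>t\<close>.\<close>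

definition gen_fun :: "(nat \<Rightarrow> 'a graph multiset) \<Rightarrow> int poly fps" where
  "gen_fun \<G> = Abs_fps (\<lambda>n. \<Sum>K\<in>#\<G> n. bw_poly K)"

definition rational_family :: "(nat \<Rightarrow> 'a graph multiset) \<Rightarrow> bool" where
  "rational_family \<G> \<longleftrightarrow>
     (\<exists>P Q :: int poly poly. coeff Q 0 \<noteq> 0 \<and>
        fps_of_poly Q * gen_fun \<G> = fps_of_poly P)"

definition family_from :: "nat \<Rightarrow> (nat \<Rightarrow> 'a graph) \<Rightarrow> nat \<Rightarrow> 'a graph multiset" where
  "family_from n0 K n = (if n0 \<le> n then {#K n#} else {#})"


subsection \<open>Graph constructions\<close>

definition path_graph :: "nat \<Rightarrow> nat graph" where
  "path_graph n = \<lparr>verts = {1..n}, edges = {{i, i + 1} | i. 1 \<le> i \<and> i < n}\<rparr>"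

text \<open>This is the cycle on \<open>n\<close> vertices only for \<open>n \<ge> 3\<close>.\<close>

definition cycle_graph :: "nat \<Rightarrow> nat graph" where
  "cycle_graph n =
     \<lparr>verts = {1..n}, edges = insert {n, 1} {{i, i + 1} | i. 1 \<le> i \<and> i < n}\<rparr>"

definition box_product :: "'a graph \<Rightarrow> 'b graph \<Rightarrow> ('a \<times> 'b) graph" where
  "box_product K K' =
     \<lparr>verts = verts K \<times> verts K',
      edges = {{(u, u'), (v, v')} | u u' v v'.
        u' = v' \<and> u' \<in> verts K' \<and> adj K u v \<or> u = v \<and> u \<in> verts K \<and> adj K' u' v'}\<rparr>"

definition disjoint_union :: "'a graph \<Rightarrow> 'b graph \<Rightarrow> ('a + 'b) graph" where
  "disjoint_union K K' =
     \<lparr>verts = Inl ` verts K \<union> Inr ` verts K',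
      edges = (`) Inl ` edges K \<union> (`) Inr ` edges K'\<rparr>"

text \<open>Vertices with the same image under \<open>f\<close> are identified; parallel edges
  arising in this way are merged.\<close>

definition identify :: "('a \<Rightarrow> 'b) \<Rightarrow> 'a graph \<Rightarrow> 'b graph" where
  "identify f K = \<lparr>verts = f ` verts K, edges = (`) f ` edges K\<rparr>"

fun glue_base :: "'a + 'a \<times> nat \<Rightarrow> 'a + 'a \<times> nat" where
  "glue_base (Inl v) = Inl v"
| "glue_base (Inr (v, i)) = (if i = 1 then Inl v else Inr (v, i))"

definition extrusion :: "'a graph \<Rightarrow> 'a graph \<Rightarrow> nat \<Rightarrow> ('a + 'a \<times> nat) graph" where
  "extrusion G H n =
     identify glue_base (disjoint_union G (box_product H (path_graph n)))"

definition earring :: "'a graph \<Rightarrow> 'a graph \<Rightarrow> nat \<Rightarrow> ('a + 'a \<times> nat) graph" where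
  "earring G H n =
     identify glue_base (disjoint_union G (box_product H (cycle_graph n)))"

text \<open>An arbitrary choice of a first and a second endpoint of an edge. The choice
  affects the subdivided graphs below only up to isomorphism.\<close>

definition endpoints :: "'a set \<Rightarrow> 'a \<times> 'a" where
  "endpoints e = (SOME p. e = {fst p, snd p})"

text \<open>The vertex at position \<open>i\<close>, for \<open>0 \<le> i \<le> k + 1\<close>, of the path that replaces
  \<open>e\<close> when it is subdivided with \<open>k\<close> new vertices.\<close>

definition subdiv_vertex :: "nat \<Rightarrow> 'a set \<Rightarrow> nat \<Rightarrow> 'a + 'a set \<times> nat" where
  "subdiv_vertex k e i =
     (if i = 0 then Inl (fst (endpoints e))
      else if i \<le> k then Inr (e, i)
      else Inl (snd (endpoints e)))"

text \<open>Every edge \<open>e\<close> is subdivided with \<open>\<nu> e\<close> new vertices; edges with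
  \<open>\<nu> e = 0\<close> are kept.\<close>

definition subdivide :: "'a graph \<Rightarrow> ('a set \<Rightarrow> nat) \<Rightarrow> ('a + 'a set \<times> nat) graph" where
  "subdivide G \<nu> =
     \<lparr>verts = Inl ` verts G \<union> {Inr (e, i) | e i. e \<in> edges G \<and> 1 \<le> i \<and> i \<le> \<nu> e},
      edges = {{subdiv_vertex (\<nu> e) e i, subdiv_vertex (\<nu> e) e (i + 1)} | e i.
                 e \<in> edges G \<and> i \<le> \<nu> e}\<rparr>"

definition subdivide_edge :: "'a graph \<Rightarrow> 'a set \<Rightarrow> nat \<Rightarrow> ('a + 'a set \<times> nat) graph" where
  "subdivide_edge G e n = subdivide G (\<lambda>e'. if e' = e then n else 0)"

text \<open>Tuples of nonnegative integers with sum \<open>n\<close>, indexed by \<open>F\<close> and extended by zero.\<close>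

definition tuples :: "'a set set \<Rightarrow> nat \<Rightarrow> ('a set \<Rightarrow> nat) set" where
  "tuples F n = {\<nu>. (\<forall>e. e \<notin> F \<longrightarrow> \<nu> e = 0) \<and> (\<Sum>e\<in>F. \<nu> e) = n}"

definition subdivision_family ::
    "'a graph \<Rightarrow> 'a set set \<Rightarrow> nat \<Rightarrow> ('a + 'a set \<times> nat) graph multiset" where
  "subdivision_family G F n = image_mset (subdivide G) (mset_set (tuples F n))"

text \<open>\<open>mset_set\<close> of an infinite set would be empty; this rules that out.\<close>

lemma finite_tuples:
  assumes "finite F"
  shows "finite (tuples F n)"
proof (rule finite_subset)
  show "tuples F n \<subseteq> {\<nu>. \<forall>e. (e \<in> F \<longrightarrow> \<nu> e \<in> {0..n}) \<and> (e \<notin> F \<longrightarrow> \<nu> e = 0)}"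
    using assms by (auto simp: tuples_def intro: member_le_sum)
  show "finite {\<nu>. \<forall>e. (e \<in> F \<longrightarrow> \<nu> e \<in> {0..n}) \<and> (e \<notin> F \<longrightarrow> \<nu> e = (0::nat))}"
    by (rule finite_set_of_finite_funs) (use assms in auto)
qed

end

theory Submission
  imports Defs
begin

text \<open>
  Every family is built from a fixed base graph by attaching chains of equal layers: copies of
  \<open>H\<close> for extrusions and earrings (a \<open>G\<close>-cylinder is an extrusion and a
  \<open>G\<close>-torus an earring with \<open>H = G\<close>), single vertices for subdivided
  edges. Whether a vertex of a layer is even-white depends only on its own layer and the two
  adjacent ones, so once the colors next to both ends of a chain are fixed, the sum over the
  colorings of a chain of length \<open>k\<close> satisfies a finite linear recurrence in
  \<open>k\<close>; its generating function solves a linear system and is rational. The black-white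
  polynomial is a finite combination, with coefficients independent of \<open>k\<close>, of such
  sums, and of products of them when several edges are subdivided. Summing over the tuples of
  lengths turns the products into products of generating functions.
\<close>

text \<open>The weight of a layer involves the layers on both sides, so single layers carry too
  little memory for a recurrence. Removing the last vertex of a chain turns its color into a new
  right end; hence the right end and the last color index the unknowns, while the left end and the
  first color are parameters. First and last colors are recorded because the base counts them among
  its own neighbors.

  Length 0 shapes the encoding. An empty chain is read as having the right end as first color and
  the left end as last color. This starts the recurrence correctly, and an edge without new vertices
  becomes a chain like any other: each endpoint sees the color of the opposite one.

  Denominators must only have a nonzero constant term, not an invertible one. Closure under sums and
  products therefore rests on the coefficients forming a domain.\<close>

unbundle fps_syntax

subsection \<open>Rational power series\<close>

definition rational_fps :: "'a::idom fps \<Rightarrow> bool" where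
  "rational_fps F \<longleftrightarrow> (\<exists>P Q. coeff Q 0 \<noteq> 0 \<and> fps_of_poly Q * F = fps_of_poly P)"

lemma rational_fps_of_poly [simp]: "rational_fps (fps_of_poly P)"
  unfolding rational_fps_def by (rule exI[of _ P], rule exI[of _ 1]) simp

lemma rational_fps_0 [simp]: "rational_fps 0"
  using rational_fps_of_poly[of 0] by simp

lemma rational_fps_1 [simp]: "rational_fps 1"
  using rational_fps_of_poly[of 1] by simp

lemma rational_fps_X [simp]: "rational_fps fps_X"
  using rational_fps_of_poly[of "[:0, 1:]"] by simp

lemma rational_fps_const [simp]: "rational_fps (fps_const c)"
  using rational_fps_of_poly[of "[:c:]"] by (simp add: fps_of_poly_const)

lemma rational_fps_add [intro]:
  assumes "rational_fps F" "rational_fps G"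
  shows "rational_fps (F + G)"
proof -
  obtain P Q P' Q' where "coeff Q 0 \<noteq> 0" "fps_of_poly Q * F = fps_of_poly P"
    "coeff Q' 0 \<noteq> 0" "fps_of_poly Q' * G = fps_of_poly P'"
    using assms unfolding rational_fps_def by blast
  moreover have "fps_of_poly (Q * Q') * (F + G) =
      fps_of_poly Q' * (fps_of_poly Q * F) + fps_of_poly Q * (fps_of_poly Q' * G)"
    by (simp add: fps_of_poly_mult algebra_simps)
  ultimately show ?thesis
    unfolding rational_fps_def
    by (intro exI[of _ "Q' * P + Q * P'"] exI[of _ "Q * Q'"])
      (simp add: fps_of_poly_mult fps_of_poly_add coeff_mult_0)
qed

lemma rational_fps_mult [intro]:
  assumes "rational_fps F" "rational_fps G"
  shows "rational_fps (F * G)"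
proof -
  obtain P Q P' Q' where "coeff Q 0 \<noteq> 0" "fps_of_poly Q * F = fps_of_poly P"
    "coeff Q' 0 \<noteq> 0" "fps_of_poly Q' * G = fps_of_poly P'"
    using assms unfolding rational_fps_def by blast
  moreover have "fps_of_poly (Q * Q') * (F * G) =
      (fps_of_poly Q * F) * (fps_of_poly Q' * G)"
    by (simp add: fps_of_poly_mult algebra_simps)
  ultimately show ?thesis
    unfolding rational_fps_def
    by (intro exI[of _ "P * P'"] exI[of _ "Q * Q'"]) (simp add: fps_of_poly_mult coeff_mult_0)
qed

lemma rational_fps_sum [intro]:
  "(\<And>i. i \<in> I \<Longrightarrow> rational_fps (F i)) \<Longrightarrow> rational_fps (\<Sum>i\<in>I. F i)"
  by (induction I rule: infinite_finite_induct) auto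

lemma rational_fps_prod [intro]:
  "(\<And>i. i \<in> I \<Longrightarrow> rational_fps (F i)) \<Longrightarrow> rational_fps (\<Prod>i\<in>I. F i)"
  by (induction I rule: infinite_finite_induct) auto

text \<open>If Q * A = P, then Q * (1 - X * A) is the polynomial Q - X * P, which has the constant
  term of Q. So the inverse is Q / (Q - X * P), although Q itself need not be invertible as a power
  series.\<close>

lemma rational_fps_inverse_one_minus_X_mult:
  fixes A :: "'a::idom fps"
  assumes "rational_fps A"
  obtains U where "rational_fps U" "U * (1 - fps_X * A) = 1"
proof -
  define U where "U = fps_right_inverse (1 - fps_X * A) 1"
  have U: "(1 - fps_X * A) * U = 1"
    unfolding U_def by (rule fps_right_inverse) simp
  obtain P Q where PQ: "coeff Q 0 \<noteq> 0" "fps_of_poly Q * A = fps_of_poly P"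
    using assms unfolding rational_fps_def by blast
  have "fps_of_poly (Q - [:0, 1:] * P) = fps_of_poly Q * (1 - fps_X * A)"
    using PQ(2) by (simp only: fps_of_poly_diff fps_of_poly_mult fps_of_poly_fps_X)
      (simp add: algebra_simps)
  then have "fps_of_poly (Q - [:0, 1:] * P) * U = fps_of_poly Q * ((1 - fps_X * A) * U)"
    by (simp only: mult.assoc)
  then have "fps_of_poly (Q - [:0, 1:] * P) * U = fps_of_poly Q"
    by (simp only: U mult_1_right)
  then have "rational_fps U"
    unfolding rational_fps_def using PQ(1)
    by (intro exI[of _ Q] exI[of _ "Q - [:0, 1:] * P"]) (simp add: coeff_mult_0)
  then show thesis
    using U by (intro that[of U]) (simp_all add: mult.commute)
qed

text \<open>A finite discrepancy is a polynomial. This absorbs the starting indices of the families,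
  below which no formula is available.\<close>

lemma rational_fps_eventually_eq:
  fixes F G :: "'a::idom fps"
  assumes "rational_fps G" "\<And>n. n \<ge> N \<Longrightarrow> F $ n = G $ n"
  shows "rational_fps F"
proof -
  define P where "P = Poly (map (\<lambda>n. F $ n - G $ n) [0..<N])"
  have "F = G + fps_of_poly P"
    using assms(2) by (auto simp: fps_eq_iff P_def coeff_Poly_eq nth_default_def)
  with assms(1) show ?thesis
    by auto
qed

text \<open>Gaussian elimination: the pivots \<open>1 - X * A s s\<close> are units of the ring of
  power series, so no determinants are needed.\<close>

lemma rational_fps_linear_system:
  fixes F :: "'s \<Rightarrow> 'a::idom fps"
  assumes "finite S"
    and "\<And>s. s \<in> S \<Longrightarrow> rational_fps (b s)"
    and "\<And>s s'. s \<in> S \<Longrightarrow> s' \<in> S \<Longrightarrow> rational_fps (A s s')"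
    and "\<And>s. s \<in> S \<Longrightarrow> F s = b s + fps_X * (\<Sum>s'\<in>S. A s s' * F s')"
    and "s \<in> S"
  shows "rational_fps (F s)"
  using assms
proof (induction S arbitrary: b A s rule: finite_induct)
  case empty
  then show ?case by simp
next
  case (insert r S)
  obtain U where U: "rational_fps U" "U * (1 - fps_X * A r r) = 1"
    using rational_fps_inverse_one_minus_X_mult[of "A r r"] insert.prems(2) by blast
  have "F r = b r + fps_X * (A r r * F r + (\<Sum>s'\<in>S. A r s' * F s'))"
    using insert.prems(3)[of r] insert.hyps by simp
  then have "(1 - fps_X * A r r) * F r = b r + fps_X * (\<Sum>s'\<in>S. A r s' * F s')"
    by (simp add: algebra_simps)
  then have "U * (1 - fps_X * A r r) * F r = U * (b r + fps_X * (\<Sum>s'\<in>S. A r s' * F s'))"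
    by (simp add: mult.assoc)
  then have Fr: "F r = U * (b r + fps_X * (\<Sum>s'\<in>S. A r s' * F s'))"
    using U(2) by simp
  \<comment> \<open>Substituting the solved row keeps a factor \<open>fps_X\<close> in front of all
    unknowns, so the next pivot again has constant coefficient 1.\<close>
  have eq: "F s = (b s + fps_X * A s r * U * b r) +
      fps_X * (\<Sum>s'\<in>S. (A s s' + fps_X * A s r * U * A r s') * F s')" if "s \<in> S" for s
  proof -
    have "F s = b s + fps_X * (A s r * F r + (\<Sum>s'\<in>S. A s s' * F s'))"
      using insert.prems(3)[of s] insert.hyps that by simp
    also have "\<dots> = b s + fps_X * (A s r * (U * (b r + fps_X * (\<Sum>s'\<in>S. A r s' * F s')))
        + (\<Sum>s'\<in>S. A s s' * F s'))"
      by (subst Fr) (rule refl)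
    finally show ?thesis
      by (simp add: algebra_simps sum.distrib sum_distrib_left)
  qed
  have rat: "rational_fps (F s)" if "s \<in> S" for s
  proof (rule insert.IH[OF _ _ eq that])
    show "rational_fps (b s + fps_X * A s r * U * b r)" if "s \<in> S" for s
      using that insert.prems(1,2) U(1) by (intro rational_fps_add rational_fps_mult) auto
    show "rational_fps (A s s' + fps_X * A s r * U * A r s')" if "s \<in> S" "s' \<in> S" for s s'
      using that insert.prems(2) U(1) by (intro rational_fps_add rational_fps_mult) auto
  qed
  have "rational_fps (F r)"
    using insert.prems(1,2) U(1) rat
    by (subst Fr, intro rational_fps_add rational_fps_mult rational_fps_sum) auto
  with rat insert.prems(4) show ?case
    by blast
qed

section \<open>Coefficientwise operations on rational series\<close>

lemma rational_fps_Abs_fps_sum: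
  assumes "\<And>i. i \<in> I \<Longrightarrow> rational_fps (Abs_fps (f i))"
  shows "rational_fps (Abs_fps (\<lambda>n. \<Sum>i\<in>I. f i n))"
proof -
  have "Abs_fps (\<lambda>n. \<Sum>i\<in>I. f i n) = (\<Sum>i\<in>I. Abs_fps (f i))"
    by (simp add: fps_eq_iff fps_sum_nth)
  then show ?thesis
    using assms by auto
qed

lemma rational_fps_Abs_fps_mult_left:
  assumes "rational_fps (Abs_fps f)"
  shows "rational_fps (Abs_fps (\<lambda>n. c * f n))"
proof -
  have "Abs_fps (\<lambda>n. c * f n) = fps_const c * Abs_fps f"
    by (simp add: fps_eq_iff)
  then show ?thesis
    using assms by auto
qed

lemma rational_fps_Abs_fps_shift:
  assumes "rational_fps (Abs_fps f)"
  shows "rational_fps (Abs_fps (\<lambda>n. f (n - 1)))"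
proof (rule rational_fps_eventually_eq)
  show "rational_fps (fps_X * Abs_fps f)"
    using assms by auto
  \<comment> \<open>At index 0 truncated subtraction yields \<open>f 0\<close> instead of 0, so the
    two series may differ there.\<close>
  show "Abs_fps (\<lambda>n. f (n - 1)) $ n = (fps_X * Abs_fps f) $ n" if "n \<ge> 1" for n
    using that by simp
qed

subsection \<open>Weighted paths\<close>

text \<open>Position 0 and all positions beyond \<open>k\<close> carry the prescribed ends, so every
  chain vertex has two neighbors. For \<open>k = 0\<close>, position 1 is the right end and position
  \<open>k\<close> the left end.\<close>

definition extend_path :: "'s \<Rightarrow> 's \<Rightarrow> nat \<Rightarrow> (nat \<Rightarrow> 's) \<Rightarrow> nat \<Rightarrow> 's" where
  "extend_path a z k x i = (if i = 0 then a else if i \<le> k then x i else z)"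

definition path_weight :: "('s \<Rightarrow> 's \<Rightarrow> 's \<Rightarrow> 'a::comm_monoid_mult) \<Rightarrow> nat \<Rightarrow> (nat \<Rightarrow> 's) \<Rightarrow> 'a" where
  "path_weight w k y = (\<Prod>i=1..k. w (y (i - 1)) (y i) (y (i + 1)))"

text \<open>The partition function of a chain with fixed surroundings: \<open>a\<close> and
  \<open>z\<close> enter the weights without being summed over, and \<open>pq\<close> is what the
  surroundings see of the chain.\<close>

definition path_sum ::
    "('s \<Rightarrow> 's \<Rightarrow> 's \<Rightarrow> 'a::comm_semiring_1) \<Rightarrow> 's set \<Rightarrow> nat \<Rightarrow> 's \<Rightarrow> 's \<Rightarrow> 's \<times> 's \<Rightarrow> 'a" where
  "path_sum w S k a z pq =
     (\<Sum>x | x \<in> {1..k} \<rightarrow>\<^sub>E S \<and> (extend_path a z k x 1, extend_path a z k x k) = pq.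
        path_weight w k (extend_path a z k x))"

lemma path_sum_0: "path_sum w S 0 a z (p, q) = of_bool (p = z \<and> q = a)"
proof -
  have "{x. x \<in> {1..0::nat} \<rightarrow>\<^sub>E S \<and> (extend_path a z 0 x 1, extend_path a z 0 x 0) = (p, q)} =
      (if p = z \<and> q = a then {\<lambda>_. undefined} else {})"
    by (auto simp: extend_path_def)
  then show ?thesis
    by (simp add: path_sum_def path_weight_def)
qed

text \<open>The last vertex has color \<open>q\<close> and neighbors \<open>r\<close> and
  \<open>z\<close>. Without it, \<open>q\<close> is the right end of a chain of length
  \<open>k\<close> with last color \<open>r\<close>. For \<open>k = 0\<close> this \<open>r\<close>
  is the left end, which is why \<open>a\<close> has to lie in \<open>S\<close>.\<close>

lemma path_sum_Suc:
  assumes "finite S" "a \<in> S" "q \<in> S"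
  shows "path_sum w S (Suc k) a z (p, q) = (\<Sum>r\<in>S. w r q z * path_sum w S k a q (p, r))"
proof -
  let ?X = "\<lambda>k z p q. {x \<in> {1..k} \<rightarrow>\<^sub>E S. (extend_path a z k x 1, extend_path a z k x k) = (p, q)}"
  let ?Y = "{x \<in> {1..k} \<rightarrow>\<^sub>E S. extend_path a q k x 1 = p}"
  \<comment> \<open>Whether \<open>q\<close> is the last color or the right end makes no difference
    up to position \<open>k + 1\<close>.\<close>
  have ext: "extend_path a z (Suc k) (x(Suc k := q)) i =
      (if i = Suc (Suc k) then z else extend_path a q k x i)" if "i \<le> Suc (Suc k)" for x i
    using that by (auto simp: extend_path_def)
  have bij: "path_sum w S (Suc k) a z (p, q) =
      (\<Sum>x\<in>?Y. path_weight w (Suc k) (extend_path a z (Suc k) (x(Suc k := q))))"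
    unfolding path_sum_def
  proof (rule sum.reindex_bij_witness[of _ "\<lambda>x. x(Suc k := q)" "\<lambda>x. restrict x {1..k}"])
    fix x assume x: "x \<in> ?X (Suc k) z p q"
    then have q: "x (Suc k) = q"
      by (auto simp: extend_path_def)
    show *: "(restrict x {1..k})(Suc k := q) = x"
      using x q by (auto simp: fun_eq_iff PiE_def extensional_def)
    show "restrict x {1..k} \<in> ?Y"
      using x q by (auto simp: PiE_def extend_path_def Suc_le_eq split: if_splits)
    show "path_weight w (Suc k) (extend_path a z (Suc k) ((restrict x {1..k})(Suc k := q))) =
        path_weight w (Suc k) (extend_path a z (Suc k) x)"
      by (simp only: *)
  next
    fix x assume x: "x \<in> ?Y"
    show "restrict (x(Suc k := q)) {1..k} = x"
      using x by (auto simp: fun_eq_iff PiE_def extensional_def)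
    show "x(Suc k := q) \<in> ?X (Suc k) z p q"
      using x assms(3) ext[of 1 x] ext[of "Suc k" x]
      by (auto simp: PiE_def extensional_def Pi_def extend_path_def)
  qed
  also have "\<dots> = (\<Sum>x\<in>?Y. w (extend_path a q k x k) q z * path_weight w k (extend_path a q k x))"
  proof (rule sum.cong[OF refl])
    fix x
    have "path_weight w k (extend_path a z (Suc k) (x(Suc k := q))) =
        path_weight w k (extend_path a q k x)"
      unfolding path_weight_def by (rule prod.cong) (auto simp: ext)
    then show "path_weight w (Suc k) (extend_path a z (Suc k) (x(Suc k := q))) =
        w (extend_path a q k x k) q z * path_weight w k (extend_path a q k x)"
      by (simp add: path_weight_def ext mult.commute) (simp add: extend_path_def)
  qed
  also have "\<dots> = (\<Sum>r\<in>S. \<Sum>x | x \<in> ?Y \<and> extend_path a q k x k = r.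
      w (extend_path a q k x k) q z * path_weight w k (extend_path a q k x))"
  proof (rule sum.group[symmetric])
    show "finite ?Y"
      using assms(1) by (simp add: finite_PiE)
    show "(\<lambda>x. extend_path a q k x k) ` ?Y \<subseteq> S"
      using assms(2) by (auto simp: extend_path_def PiE_def)
  qed (use assms in auto)
  also have "\<dots> = (\<Sum>r\<in>S. w r q z * path_sum w S k a q (p, r))"
    unfolding path_sum_def sum_distrib_left by (intro sum.cong) auto
  finally show ?thesis .
qed

text \<open>Transfer matrix method, with pairs of consecutive states as the states of the walk.\<close>

lemma rational_fps_path_sum:
  fixes w :: "'s \<Rightarrow> 's \<Rightarrow> 's \<Rightarrow> 'a::idom"
  assumes "finite S" "a \<in> S" "z \<in> S" "q \<in> S"
  shows "rational_fps (Abs_fps (\<lambda>k. path_sum w S k a z (p, q)))"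
proof -
  define F where "F = (\<lambda>(z, q). Abs_fps (\<lambda>k. path_sum w S k a z (p, q)))"
  define b where "b = (\<lambda>(z, q). fps_const (of_bool (p = z \<and> q = a) :: 'a))"
  \<comment> \<open>Only pairs whose right end is \<open>q\<close> can contribute to
    \<open>(z, q)\<close>: the removed vertex leaves its color as the new right end.\<close>
  define A where "A = (\<lambda>(z, q) (z', r). fps_const (of_bool (z' = q) * w r q z))"
  have "rational_fps (F (z, q))"
  proof (rule rational_fps_linear_system[where S = "S \<times> S" and b = b and A = A])
    fix s assume "s \<in> S \<times> S"
    then obtain z q where s: "s = (z, q)" "z \<in> S" "q \<in> S"
      by auto
    have "(\<Sum>s'\<in>S \<times> S. A s s' * F s') = (\<Sum>z'\<in>S. \<Sum>r\<in>S. A s (z', r) * F (z', r))"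
      by (simp add: sum.cartesian_product)
    also have "\<dots> = (\<Sum>z'\<in>S. if z' = q then \<Sum>r\<in>S. fps_const (w r q z) * F (q, r) else 0)"
      by (intro sum.cong) (auto simp: A_def s(1))
    also have "\<dots> = (\<Sum>r\<in>S. fps_const (w r q z) * F (q, r))"
      using s assms(1) by simp
    finally have *: "(\<Sum>s'\<in>S \<times> S. A s s' * F s') = (\<Sum>r\<in>S. fps_const (w r q z) * F (q, r))" .
    show "F s = b s + fps_X * (\<Sum>s'\<in>S \<times> S. A s s' * F s')"
      unfolding *
    proof (rule fps_ext)
      fix n show "F s $ n = (b s + fps_X * (\<Sum>r\<in>S. fps_const (w r q z) * F (q, r))) $ n"
        using s assms(1,2)
        by (cases n) (simp_all add: F_def b_def path_sum_0 path_sum_Suc fps_sum_nth)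
    qed
  qed (use assms in \<open>auto simp: A_def b_def\<close>)
  then show ?thesis
    by (simp add: F_def)
qed

subsection \<open>The black-white polynomial as a state sum\<close>

lemma adj_commute: "adj K u v \<longleftrightarrow> adj K v u"
  by (simp add: adj_def insert_commute)

lemma simple_graph_adjD:
  assumes "simple_graph K" "adj K u v"
  shows "u \<in> verts K" "v \<in> verts K" "u \<noteq> v"
  using assms by (fastforce simp: simple_graph_def adj_def)+

text \<open>The local factor of a vertex of color \<open>a\<close> with \<open>m\<close> black
  neighbors; \<open>monom 1 1\<close> is the variable t.\<close>

definition vertex_weight :: "nat \<Rightarrow> nat \<Rightarrow> int poly" where
  "vertex_weight a m = (if a = 0 \<and> even m then monom 1 1 else 1)"

text \<open>The exponent counts vertices one at a time, so the power of t splits into local factors.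
  Black has the value 1, so the number of black neighbors is a sum of colors, which can later be
  divided between base and chains.\<close>

lemma bw_poly_eq_sum_prod:
  assumes "finite (verts K)"
  shows "bw_poly K = (\<Sum>c\<in>colorings K. \<Prod>v\<in>verts K.
    vertex_weight (c v) (\<Sum>u\<in>verts K. of_bool (adj K v u) * c u))"
  unfolding bw_poly_def
proof (rule sum.cong[OF refl])
  fix c assume c: "c \<in> colorings K"
  have count: "(\<Sum>u\<in>verts K. of_bool (adj K v u) * c u) = card {u \<in> verts K. adj K v u \<and> c u = 1}" for v
  proof -
    have "(\<Sum>u\<in>verts K. of_bool (adj K v u) * c u) = (\<Sum>u\<in>verts K. of_bool (adj K v u \<and> c u = 1))"
      using c by (intro sum.cong) (auto simp: colorings_def PiE_def Pi_def)
    then show ?thesis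
      using assms by (simp add: sum.If_cases of_bool_def Int_def)
  qed
  have "(\<Prod>v\<in>verts K. vertex_weight (c v) (\<Sum>u\<in>verts K. of_bool (adj K v u) * c u)) =
      (\<Prod>v\<in>verts K. if v \<in> even_white K c then monom 1 1 else 1)"
    by (intro prod.cong) (auto simp: count vertex_weight_def even_white_def)
  also have "\<dots> = monom 1 1 ^ card (even_white K c)"
    using assms by (simp add: prod.If_cases) (simp add: even_white_def Int_def)
  finally show "monom 1 (card (even_white K c)) =
      (\<Prod>v\<in>verts K. vertex_weight (c v) (\<Sum>u\<in>verts K. of_bool (adj K v u) * c u))"
    by (simp add: monom_power)
qed

text \<open>Colorings of a disjoint sum are pairs of colorings. The left summand is meant for the
  fixed base, the right one for the chain vertices.\<close>

lemma bw_poly_Plus: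
  assumes "finite A" "finite B" "verts K = A <+> B"
  shows "bw_poly K = (\<Sum>g\<in>A \<rightarrow>\<^sub>E {0, 1}. \<Sum>x\<in>B \<rightarrow>\<^sub>E {0, 1}.
    (\<Prod>v\<in>A. vertex_weight (g v) ((\<Sum>u\<in>A. of_bool (adj K (Inl v) (Inl u)) * g u) +
       (\<Sum>b\<in>B. of_bool (adj K (Inl v) (Inr b)) * x b))) *
    (\<Prod>b\<in>B. vertex_weight (x b) ((\<Sum>u\<in>A. of_bool (adj K (Inr b) (Inl u)) * g u) +
       (\<Sum>b'\<in>B. of_bool (adj K (Inr b) (Inr b')) * x b'))))"
proof -
  have fin: "finite (verts K)"
    using assms by simp
  show ?thesis
    unfolding bw_poly_eq_sum_prod[OF fin] sum.cartesian_product
  proof (rule sum.reindex_bij_witness[of _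
        "\<lambda>(g, x). restrict (case_sum g x) (A <+> B)"
        "\<lambda>c. (restrict (c \<circ> Inl) A, restrict (c \<circ> Inr) B)"])
    fix c assume "c \<in> colorings K"
    then have c: "c \<in> (A <+> B) \<rightarrow>\<^sub>E {0, 1}"
      using assms by (simp add: colorings_def)
    show "(case (restrict (c \<circ> Inl) A, restrict (c \<circ> Inr) B) of
        (g, x) \<Rightarrow> restrict (case_sum g x) (A <+> B)) = c"
      using c by (auto simp: fun_eq_iff restrict_def PiE_def extensional_def split: sum.split)
    show "(restrict (c \<circ> Inl) A, restrict (c \<circ> Inr) B) \<in> (A \<rightarrow>\<^sub>E {0, 1}) \<times> (B \<rightarrow>\<^sub>E {0, 1})"
      using c by (auto simp: PiE_def Pi_def)
    show "(\<lambda>(g, x). (\<Prod>v\<in>A. vertex_weight (g v) ((\<Sum>u\<in>A. of_bool (adj K (Inl v) (Inl u)) * g u) +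
         (\<Sum>b\<in>B. of_bool (adj K (Inl v) (Inr b)) * x b))) *
      (\<Prod>b\<in>B. vertex_weight (x b) ((\<Sum>u\<in>A. of_bool (adj K (Inr b) (Inl u)) * g u) +
         (\<Sum>b'\<in>B. of_bool (adj K (Inr b) (Inr b')) * x b'))))
      (restrict (c \<circ> Inl) A, restrict (c \<circ> Inr) B) =
      (\<Prod>v\<in>verts K. vertex_weight (c v) (\<Sum>u\<in>verts K. of_bool (adj K v u) * c u))"
      unfolding assms(3) using assms(1,2) by (simp add: sum.Plus prod.Plus del: sum_of_bool_mult_eq)
  next
    fix p :: "('a \<Rightarrow> nat) \<times> ('b \<Rightarrow> nat)"
    assume "p \<in> (A \<rightarrow>\<^sub>E {0, 1}) \<times> (B \<rightarrow>\<^sub>E {0, 1})"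
    then obtain g x where p: "p = (g, x)" and g: "g \<in> A \<rightarrow>\<^sub>E {0, 1}" and x: "x \<in> B \<rightarrow>\<^sub>E {0, 1}"
      by auto
    show "(\<lambda>c. (restrict (c \<circ> Inl) A, restrict (c \<circ> Inr) B))
        (case p of (g, x) \<Rightarrow> restrict (case_sum g x) (A <+> B)) = p"
      using g x by (auto simp: p fun_eq_iff PiE_def extensional_def)
    show "(case p of (g, x) \<Rightarrow> restrict (case_sum g x) (A <+> B)) \<in> colorings K"
      using g x assms by (auto simp: p colorings_def PiE_def Pi_def)
  qed
qed

text \<open>An injective relabeling is an isomorphism. This serves the passage from box products to
  glued graphs; the gluing of the disjoint union itself is in general not injective.\<close>

lemma bw_poly_identify:
  assumes "finite (verts K)" "inj_on f (verts K)" "\<And>e. e \<in> edges K \<Longrightarrow> e \<subseteq> verts K"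
  shows "bw_poly (identify f K) = bw_poly K"
proof -
  let ?K = "identify f K"
  have verts: "verts ?K = f ` verts K"
    by (simp add: identify_def)
  have fin: "finite (verts ?K)"
    using assms(1) by (simp add: verts)
  have adj: "adj ?K (f v) (f u) \<longleftrightarrow> adj K v u" if "v \<in> verts K" "u \<in> verts K" for v u
  proof -
    have "f ` {v, u} \<in> (`) f ` edges K \<longleftrightarrow> {v, u} \<in> edges K"
      using that assms(2,3)
      by (intro inj_on_image_mem_iff[of _ "Pow (verts K)"] inj_on_image_Pow) auto
    then show ?thesis
      by (simp add: adj_def identify_def)
  qed
  show ?thesis
    unfolding bw_poly_eq_sum_prod[OF fin] bw_poly_eq_sum_prod[OF assms(1)]
  proof (rule sum.reindex_bij_witness[of _
        "\<lambda>c. restrict (c \<circ> inv_into (verts K) f) (verts ?K)" "\<lambda>c. restrict (c \<circ> f) (verts K)"])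
    fix c assume "c \<in> colorings ?K"
    then have c: "c \<in> (f ` verts K) \<rightarrow>\<^sub>E {0, 1}"
      by (simp add: colorings_def verts)
    show "restrict (restrict (c \<circ> f) (verts K) \<circ> inv_into (verts K) f) (verts ?K) = c"
      using c assms(2)
      by (auto simp: fun_eq_iff verts PiE_def extensional_def restrict_def inv_into_into)
    show "restrict (c \<circ> f) (verts K) \<in> colorings K"
      using c by (auto simp: colorings_def PiE_def Pi_def)
    show "(\<Prod>v\<in>verts K. vertex_weight (restrict (c \<circ> f) (verts K) v)
          (\<Sum>u\<in>verts K. of_bool (adj K v u) * restrict (c \<circ> f) (verts K) u)) =
        (\<Prod>v\<in>verts ?K. vertex_weight (c v) (\<Sum>u\<in>verts ?K. of_bool (adj ?K v u) * c u))"
      by (simp add: verts prod.reindex[OF assms(2)] sum.reindex[OF assms(2)] adj)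
  next
    fix c assume "c \<in> colorings K"
    then have c: "c \<in> verts K \<rightarrow>\<^sub>E {0, 1}"
      by (simp add: colorings_def)
    show "restrict (restrict (c \<circ> inv_into (verts K) f) (verts ?K) \<circ> f) (verts K) = c"
      using c assms(2) by (auto simp: fun_eq_iff verts PiE_def extensional_def)
    show "restrict (c \<circ> inv_into (verts K) f) (verts ?K) \<in> colorings ?K"
      using c assms(2) by (auto simp: colorings_def verts PiE_def Pi_def)
  qed
qed

lemma rational_family_family_from:
  assumes "rational_fps (Abs_fps a)" "\<And>n. n \<ge> n0 \<Longrightarrow> bw_poly (K n) = a n"
  shows "rational_family (family_from n0 K)"
proof -
  have "rational_fps (gen_fun (family_from n0 K))"
  proof (rule rational_fps_eventually_eq[OF assms(1)])
    show "gen_fun (family_from n0 K) $ n = Abs_fps a $ n" if "n \<ge> n0" for n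
      using that assms(2) by (simp add: gen_fun_def family_from_def)
  qed
  then show ?thesis
    by (simp add: rational_family_def rational_fps_def)
qed

subsection \<open>Extrusions, earrings and products\<close>

text \<open>Extrusions and earrings differ only in \<open>L\<close>, a path or a cycle, and share
  most of the argument.\<close>

definition glued :: "'a graph \<Rightarrow> 'a graph \<Rightarrow> nat graph \<Rightarrow> ('a + 'a \<times> nat) graph" where
  "glued G H L = identify glue_base (disjoint_union G (box_product H L))"

text \<open>Layer 1 is absorbed by the base, so the free layers start at 2. Of \<open>k + 1\<close>
  layers, \<open>k\<close> remain as a chain.\<close>

lemma verts_glued:
  assumes "verts L = {1..Suc k}" "verts H \<subseteq> verts G"
  shows "verts (glued G H L) = verts G <+> verts H \<times> {2..Suc k}"
proof (intro equalityI subsetI)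
  fix x assume "x \<in> verts (glued G H L)"
  then show "x \<in> verts G <+> verts H \<times> {2..Suc k}"
    using assms
    by (auto simp: glued_def identify_def disjoint_union_def box_product_def subset_iff)
next
  fix x assume "x \<in> verts G <+> verts H \<times> {2..Suc k}"
  then consider v where "v \<in> verts G" "x = glue_base (Inl v)"
    | u i where "u \<in> verts H" "i \<in> {2..Suc k}" "x = glue_base (Inr (u, i))"
    by (auto elim!: PlusE)
  then show "x \<in> verts (glued G H L)"
    using assms(1)
    by cases (auto simp: glued_def identify_def disjoint_union_def box_product_def simp del: glue_base.simps
        intro!: imageI)
qed

lemma image_edges_box_product:
  "(`) f ` edges (box_product H L) =
     {{f (u, i), f (v, i)} | u v i. i \<in> verts L \<and> adj H u v} \<union>
     {{f (u, i), f (u, j)} | u i j. u \<in> verts H \<and> adj L i j}"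
proof -
  have "edges (box_product H L) =
      {{(u, i), (v, i)} | u v i. i \<in> verts L \<and> adj H u v} \<union>
      {{(u, i), (u, j)} | u i j. u \<in> verts H \<and> adj L i j}"
    by (simp add: box_product_def) blast
  moreover have "(`) f ` {{(u, i), (v, i)} | u v i. i \<in> verts L \<and> adj H u v} =
      {{f (u, i), f (v, i)} | u v i. i \<in> verts L \<and> adj H u v}"
    unfolding image_Collect by auto (metis image_insert image_empty)+
  moreover have "(`) f ` {{(u, i), (u, j)} | u i j. u \<in> verts H \<and> adj L i j} =
      {{f (u, i), f (u, j)} | u i j. u \<in> verts H \<and> adj L i j}"
    unfolding image_Collect by auto (metis image_insert image_empty)+
  ultimately show ?thesis
    by (simp add: image_Un)
qed

lemma edges_glued:
  "edges (glued G H L) = (`) Inl ` edges G \<union>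
     {{glue_base (Inr (u, i)), glue_base (Inr (v, i))} | u v i. i \<in> verts L \<and> adj H u v} \<union>
     {{glue_base (Inr (u, i)), glue_base (Inr (u, j))} | u i j. u \<in> verts H \<and> adj L i j}"
proof -
  have "(`) glue_base ` (`) Inl ` edges G = (`) Inl ` edges G"
    by (simp add: image_image)
  moreover have "(`) glue_base ` (`) Inr ` edges (box_product H L) =
      (`) (\<lambda>p. glue_base (Inr p)) ` edges (box_product H L)"
    by (simp add: image_image)
  ultimately show ?thesis
    by (simp add: glued_def identify_def disjoint_union_def image_Un image_edges_box_product
        Un_assoc del: glue_base.simps)
qed

lemma adj_glued:
  assumes "subgraph H G" "verts L = {1..Suc k}" "simple_graph L"
  shows "adj (glued G H L) (Inl v) (Inl u) \<longleftrightarrow> adj G v u"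
    and "i \<in> {2..Suc k} \<Longrightarrow>
      adj (glued G H L) (Inl v) (Inr (u, i)) \<longleftrightarrow> v = u \<and> u \<in> verts H \<and> adj L 1 i"
    and "i \<in> {2..Suc k} \<Longrightarrow>
      adj (glued G H L) (Inr (u, i)) (Inl v) \<longleftrightarrow> v = u \<and> u \<in> verts H \<and> adj L i 1"
    and "i \<in> {2..Suc k} \<Longrightarrow> j \<in> {2..Suc k} \<Longrightarrow>
      adj (glued G H L) (Inr (v, i)) (Inr (u, j)) \<longleftrightarrow>
        i = j \<and> adj H v u \<or> v = u \<and> u \<in> verts H \<and> adj L i j"
proof -
  \<comment> \<open>Edges inside layer 1 come from \<open>H\<close> and fall on edges of
    \<open>G\<close>, so gluing adds no adjacency within the base.\<close>
  have HG: "adj H u v \<Longrightarrow> adj G u v" "adj H v u \<Longrightarrow> adj G u v" for u v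
    using assms(1) by (auto simp: subgraph_def adj_def insert_commute)
  \<comment> \<open>A loop of \<open>L\<close> at 1 would become a loop at a base vertex.\<close>
  have L: "\<not> adj L i i" "adj L i j \<longleftrightarrow> adj L j i" for i j
    using simple_graph_adjD[OF assms(3)] adj_commute by metis+
  have pair_image: "{x, y} = f ` e \<Longrightarrow> \<exists>p q. x = f p \<and> y = f q \<and> e = {p, q}" if "inj f" for x y f e
  proof -
    assume *: "{x, y} = f ` e"
    then obtain p q where "p \<in> e" "q \<in> e" "x = f p" "y = f q"
      by blast
    moreover from this * have "f ` e = f ` {p, q}"
      by simp
    then have "e = {p, q}"
      using \<open>inj f\<close> by (simp only: inj_image_eq_iff)
    ultimately show ?thesis
      by blast
  qed
  have Inl: "{x, y} \<in> (`) Inl ` edges G \<longleftrightarrow> (\<exists>p q. x = Inl p \<and> y = Inl q \<and> adj G p q)" for x y :: "'a + 'a \<times> nat"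
  proof
    assume "{x, y} \<in> (`) Inl ` edges G"
    then obtain e where "e \<in> edges G" "{x, y} = Inl ` e"
      by auto
    with pair_image[OF inj_Inl this(2)] show "\<exists>p q. x = Inl p \<and> y = Inl q \<and> adj G p q"
      by (auto simp: adj_def)
  next
    assume "\<exists>p q. x = Inl p \<and> y = Inl q \<and> adj G p q"
    then obtain p q where "{x, y} = Inl ` {p, q}" "{p, q} \<in> edges G"
      by (auto simp: adj_def)
    then show "{x, y} \<in> (`) Inl ` edges G"
      by (rule image_eqI)
  qed
  show "adj (glued G H L) (Inl v) (Inl u) \<longleftrightarrow> adj G v u"
    using L unfolding adj_def[of "glued G H L"] edges_glued Un_iff Inl
    by (auto simp: doubleton_eq_iff adj_commute[of G] intro: HG split: if_splits)
  show *: "adj (glued G H L) (Inl v) (Inr (u, i)) \<longleftrightarrow> v = u \<and> u \<in> verts H \<and> adj L 1 i"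
    if "i \<in> {2..Suc k}" for u v i
  proof
    assume "adj (glued G H L) (Inl v) (Inr (u, i))"
    then show "v = u \<and> u \<in> verts H \<and> adj L 1 i"
      using that L(2) unfolding adj_def[of "glued G H L"] edges_glued Un_iff Inl
      by (auto simp: doubleton_eq_iff split: if_splits)
  next
    assume "v = u \<and> u \<in> verts H \<and> adj L 1 i"
    moreover have "{Inl u, Inr (u, i)} = {glue_base (Inr (u, 1)), glue_base (Inr (u, i))}"
      using that by auto
    ultimately show "adj (glued G H L) (Inl v) (Inr (u, i))"
      unfolding adj_def[of "glued G H L"] edges_glued by blast
  qed
  show "adj (glued G H L) (Inr (u, i)) (Inl v) \<longleftrightarrow> v = u \<and> u \<in> verts H \<and> adj L i 1"
    if "i \<in> {2..Suc k}" for u v i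
    using *[OF that] L(2) adj_commute by metis
  show "adj (glued G H L) (Inr (v, i)) (Inr (u, j)) \<longleftrightarrow>
      i = j \<and> adj H v u \<or> v = u \<and> u \<in> verts H \<and> adj L i j"
    if "i \<in> {2..Suc k}" "j \<in> {2..Suc k}"
  proof
    assume "adj (glued G H L) (Inr (v, i)) (Inr (u, j))"
    then show "i = j \<and> adj H v u \<or> v = u \<and> u \<in> verts H \<and> adj L i j"
      using that L(2) unfolding adj_def[of "glued G H L"] edges_glued Un_iff Inl
      by (auto simp: doubleton_eq_iff adj_commute[of H] split: if_splits)
  next
    assume "i = j \<and> adj H v u \<or> v = u \<and> u \<in> verts H \<and> adj L i j"
    moreover have "{Inr (v, i), Inr (u, j)} = {glue_base (Inr (v, i)), glue_base (Inr (u, j))}"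
      "i \<in> verts L"
      using that assms(2) by auto
    ultimately show "adj (glued G H L) (Inr (v, i)) (Inr (u, j))"
      unfolding adj_def[of "glued G H L"] edges_glued by blast
  qed
qed


text \<open>Neighbors within a layer and neighbors along the chain could coincide only at
  \<open>(u, i)\<close> itself, which \<open>\<not> R u u\<close> excludes. So the indicator of the
  disjunction is the sum of the indicators.\<close>

lemma sum_of_bool_disj_Times:
  fixes x :: "'a \<times> nat \<Rightarrow> nat"
  assumes "finite U" "finite I" "u \<in> U" "i \<in> I" "\<not> R u u"
  shows "(\<Sum>(u', i')\<in>U \<times> I. of_bool (i = i' \<and> R u u' \<or> u = u' \<and> u' \<in> U \<and> T i i') * x (u', i')) =
    (\<Sum>u'\<in>U. of_bool (R u u') * x (u', i)) + (\<Sum>i'\<in>I. of_bool (T i i') * x (u, i'))"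
proof -
  have "(\<Sum>(u', i')\<in>U \<times> I. of_bool (i = i' \<and> R u u' \<or> u = u' \<and> u' \<in> U \<and> T i i') * x (u', i')) =
      (\<Sum>u'\<in>U. \<Sum>i'\<in>I. (if i = i' then of_bool (R u u') * x (u', i) else 0) +
        (if u = u' then of_bool (T i i') * x (u, i') else 0))"
    unfolding sum.cartesian_product[symmetric] using assms(5) by (intro sum.cong) auto
  also have "\<dots> = (\<Sum>u'\<in>U. of_bool (R u u') * x (u', i)) +
      (\<Sum>u'\<in>U. if u = u' then \<Sum>i'\<in>I. of_bool (T i i') * x (u, i') else 0)"
    using assms(2,4)
    by (auto simp: sum.distrib simp del: sum_of_bool_mult_eq intro!: sum.cong)
  finally show ?thesis
    using assms(1,3) by (simp del: sum_of_bool_mult_eq)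
qed

text \<open>A coloring of the free layers is read as a sequence of colorings of \<open>H\<close>,
  which are the states of the chain. Chain position \<open>i\<close> is layer \<open>i + 1\<close>
  of \<open>L\<close>.\<close>

lemma bw_poly_glued:
  assumes "simple_graph G" "subgraph H G" "verts L = {1..Suc k}" "simple_graph L"
  shows "bw_poly (glued G H L) =
    (\<Sum>g\<in>verts G \<rightarrow>\<^sub>E {0, 1}. \<Sum>y\<in>{1..k} \<rightarrow>\<^sub>E (verts H \<rightarrow>\<^sub>E {0, 1}).
      (\<Prod>v\<in>verts G. vertex_weight (g v) ((\<Sum>u\<in>verts G. of_bool (adj G v u) * g u) +
         of_bool (v \<in> verts H) * (\<Sum>i=1..k. of_bool (adj L 1 (Suc i)) * y i v))) *
      (\<Prod>i=1..k. \<Prod>u\<in>verts H. vertex_weight (y i u) ((\<Sum>u'\<in>verts H. of_bool (adj H u u') * y i u') +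
         (of_bool (adj L (Suc i) 1) * g u + (\<Sum>i'=1..k. of_bool (adj L (Suc i) (Suc i')) * y i' u)))))"
    (is "_ = (\<Sum>g\<in>_. \<Sum>y\<in>_. ?A g y * ?B g y)")
proof -
  let ?V = "verts G" and ?U = "verts H" and ?K = "glued G H L"
  have UV: "?U \<subseteq> ?V" and H: "simple_graph H"
    using assms(2) by (auto simp: subgraph_def)
  have fin: "finite ?V" "finite ?U"
    using assms(1) H by (auto simp: simple_graph_def)
  have verts: "verts ?K = ?V <+> ?U \<times> {2..Suc k}"
    by (rule verts_glued[OF assms(3) UV])
  note adj = adj_glued[OF assms(2-4)]
  have shift: "(\<Sum>i=2..Suc k. f i) = (\<Sum>i=1..k. f (Suc i))" for f :: "nat \<Rightarrow> nat"
    using sum.shift_bounds_cl_Suc_ivl[of f 1 k] by (simp add: numeral_2_eq_2)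
  have pshift: "(\<Prod>i=2..Suc k. f i) = (\<Prod>i=1..k. f (Suc i))" for f :: "nat \<Rightarrow> int poly"
    using prod.shift_bounds_cl_Suc_ivl[of f 1 k] by (simp add: numeral_2_eq_2)
  have "bw_poly ?K = (\<Sum>g\<in>?V \<rightarrow>\<^sub>E {0, 1}. \<Sum>x\<in>(?U \<times> {2..Suc k}) \<rightarrow>\<^sub>E {0, 1}.
      ?A g (\<lambda>i v. x (v, Suc i)) * ?B g (\<lambda>i v. x (v, Suc i)))"
    unfolding bw_poly_Plus[OF fin(1) finite_cartesian_product[OF fin(2) finite_atLeastAtMost] verts]
  proof (intro sum.cong refl arg_cong2[where f = "(*)"])
    fix g x
    show "(\<Prod>v\<in>?V. vertex_weight (g v) ((\<Sum>u\<in>?V. of_bool (adj ?K (Inl v) (Inl u)) * g u) +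
        (\<Sum>b\<in>?U \<times> {2..Suc k}. of_bool (adj ?K (Inl v) (Inr b)) * x b))) = ?A g (\<lambda>i v. x (v, Suc i))"
    proof (intro prod.cong refl arg_cong2[where f = vertex_weight] arg_cong2[where f = "(+)"])
      fix v assume "v \<in> ?V"
      have "(\<Sum>b\<in>?U \<times> {2..Suc k}. of_bool (adj ?K (Inl v) (Inr b)) * x b) =
          (\<Sum>u\<in>?U. \<Sum>i=2..Suc k. if v = u then of_bool (adj L 1 i) * x (u, i) else 0)"
        unfolding sum.cartesian_product by (intro sum.cong) (auto simp: adj(2))
      also have "\<dots> = (\<Sum>u\<in>?U. if v = u then \<Sum>i=2..Suc k. of_bool (adj L 1 i) * x (u, i) else 0)"
        by (intro sum.cong) auto
      also have "\<dots> = of_bool (v \<in> ?U) * (\<Sum>i=2..Suc k. of_bool (adj L 1 i) * x (v, i))"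
        using fin(2) by (simp del: sum_of_bool_mult_eq)
      finally show "(\<Sum>b\<in>?U \<times> {2..Suc k}. of_bool (adj ?K (Inl v) (Inr b)) * x b) =
          of_bool (v \<in> ?U) * (\<Sum>i=1..k. of_bool (adj L 1 (Suc i)) * x (v, Suc i))"
        by (simp only: shift)
    qed (simp add: adj(1))
    show "(\<Prod>b\<in>?U \<times> {2..Suc k}. vertex_weight (x b) ((\<Sum>u\<in>?V. of_bool (adj ?K (Inr b) (Inl u)) * g u) +
        (\<Sum>b'\<in>?U \<times> {2..Suc k}. of_bool (adj ?K (Inr b) (Inr b')) * x b'))) = ?B g (\<lambda>i v. x (v, Suc i))"
    proof -
      \<comment> \<open>The vertex \<open>(u, i)\<close> can have neighbors in its own layer, the
        base vertex \<open>u\<close> if \<open>i\<close> is adjacent to 1 in \<open>L\<close>, and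
        copies of \<open>u\<close> in other free layers.\<close>
      have *: "vertex_weight (x (u, i)) ((\<Sum>v\<in>?V. of_bool (adj ?K (Inr (u, i)) (Inl v)) * g v) +
          (\<Sum>b'\<in>?U \<times> {2..Suc k}. of_bool (adj ?K (Inr (u, i)) (Inr b')) * x b')) =
        vertex_weight (x (u, i)) ((\<Sum>u'\<in>?U. of_bool (adj H u u') * x (u', i)) +
         (of_bool (adj L i 1) * g u + (\<Sum>i'=1..k. of_bool (adj L i (Suc i')) * x (u, Suc i'))))"
        if "u \<in> ?U" "i \<in> {2..Suc k}" for u i
      proof -
        have "(\<Sum>v\<in>?V. of_bool (adj ?K (Inr (u, i)) (Inl v)) * g v) =
            (\<Sum>v\<in>?V. if v = u then of_bool (adj L i 1) * g u else 0)"
          using that by (intro sum.cong) (auto simp: adj(3))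
        also have "\<dots> = of_bool (adj L i 1) * g u"
          using fin(1) that UV by (simp add: subset_iff)
        finally have 1: "(\<Sum>v\<in>?V. of_bool (adj ?K (Inr (u, i)) (Inl v)) * g v) = of_bool (adj L i 1) * g u" .
        have "(\<Sum>b'\<in>?U \<times> {2..Suc k}. of_bool (adj ?K (Inr (u, i)) (Inr b')) * x b') =
            (\<Sum>(u', i')\<in>?U \<times> {2..Suc k}.
              of_bool (i = i' \<and> adj H u u' \<or> u = u' \<and> u' \<in> ?U \<and> adj L i i') * x (u', i'))"
          using that by (intro sum.cong) (auto simp: adj(4))
        also have "\<dots> = (\<Sum>u'\<in>?U. of_bool (adj H u u') * x (u', i)) +
            (\<Sum>i'=2..Suc k. of_bool (adj L i i') * x (u, i'))"
          using that simple_graph_adjD(3)[OF H] fin(2) by (intro sum_of_bool_disj_Times) auto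
        finally show ?thesis
          unfolding 1 by (simp only: shift add.commute add.left_commute)
      qed
      have "(\<Prod>b\<in>?U \<times> {2..Suc k}. vertex_weight (x b)
            ((\<Sum>u\<in>?V. of_bool (adj ?K (Inr b) (Inl u)) * g u) +
             (\<Sum>b'\<in>?U \<times> {2..Suc k}. of_bool (adj ?K (Inr b) (Inr b')) * x b'))) =
          (\<Prod>(u, i)\<in>?U \<times> {2..Suc k}. vertex_weight (x (u, i))
            ((\<Sum>u'\<in>?U. of_bool (adj H u u') * x (u', i)) +
             (of_bool (adj L i 1) * g u + (\<Sum>i'=1..k. of_bool (adj L i (Suc i')) * x (u, Suc i')))))"
        by (rule prod.cong[OF refl]) (use * in auto)
      then show ?thesis
        unfolding prod.cartesian_product[symmetric] prod.swap[of _ _ ?U] by (simp only: pshift)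
    qed
  qed
  also have "\<dots> = (\<Sum>g\<in>?V \<rightarrow>\<^sub>E {0, 1}. \<Sum>y\<in>{1..k} \<rightarrow>\<^sub>E (?U \<rightarrow>\<^sub>E {0, 1}). ?A g y * ?B g y)"
  proof (intro sum.cong refl)
    fix g
    show "(\<Sum>x\<in>(?U \<times> {2..Suc k}) \<rightarrow>\<^sub>E {0, 1}. ?A g (\<lambda>i v. x (v, Suc i)) * ?B g (\<lambda>i v. x (v, Suc i))) =
        (\<Sum>y\<in>{1..k} \<rightarrow>\<^sub>E (?U \<rightarrow>\<^sub>E {0, 1}). ?A g y * ?B g y)"
    proof (rule sum.reindex_bij_witness[of _
          "\<lambda>y. restrict (\<lambda>(u, j). y (j - 1) u) (?U \<times> {2..Suc k})"
          "\<lambda>x. \<lambda>i\<in>{1..k}. \<lambda>u\<in>?U. x (u, Suc i)"])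
      fix x assume x: "x \<in> (?U \<times> {2..Suc k}) \<rightarrow>\<^sub>E {0, 1 :: nat}"
      show "restrict (\<lambda>(u, j). (\<lambda>i\<in>{1..k}. \<lambda>u\<in>?U. x (u, Suc i)) (j - 1) u) (?U \<times> {2..Suc k}) = x"
        using x by (auto simp: fun_eq_iff PiE_def extensional_def)
      show "(\<lambda>i\<in>{1..k}. \<lambda>u\<in>?U. x (u, Suc i)) \<in> {1..k} \<rightarrow>\<^sub>E (?U \<rightarrow>\<^sub>E {0, 1})"
        using x by (auto simp: PiE_def Pi_def)
      show "?A g (\<lambda>i\<in>{1..k}. \<lambda>u\<in>?U. x (u, Suc i)) * ?B g (\<lambda>i\<in>{1..k}. \<lambda>u\<in>?U. x (u, Suc i)) =
          ?A g (\<lambda>i v. x (v, Suc i)) * ?B g (\<lambda>i v. x (v, Suc i))"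
        by (rule arg_cong2[where f = "(*)"]; intro prod.cong refl arg_cong2[where f = vertex_weight]
            arg_cong2[where f = "(+)"]; auto simp: of_bool_def)
    next
      fix y assume y: "y \<in> {1..k} \<rightarrow>\<^sub>E (?U \<rightarrow>\<^sub>E {0, 1 :: nat})"
      show "(\<lambda>i\<in>{1..k}. \<lambda>u\<in>?U. restrict (\<lambda>(u, j). y (j - 1) u) (?U \<times> {2..Suc k}) (u, Suc i)) = y"
        using y by (fastforce simp: fun_eq_iff PiE_def Pi_def extensional_def)
      show "restrict (\<lambda>(u, j). y (j - 1) u) (?U \<times> {2..Suc k}) \<in> ?U \<times> {2..Suc k} \<rightarrow>\<^sub>E {0, 1}"
      proof -
        have *: "y (j - 1) u \<in> {0, 1}" if "u \<in> ?U" "j \<in> {2..Suc k}" for u j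
          using that by (intro PiE_mem[OF PiE_mem[OF y]]) auto
        show ?thesis
          unfolding restrict_PiE_iff by (intro ballI, elim SigmaE, simp only: prod.case *)
      qed
    qed
  qed
  finally show ?thesis .
qed

text \<open>Layer 1 of the product is already a full copy of \<open>G\<close>, so gluing
  \<open>G\<close> onto it adds neither vertices nor edges.\<close>

lemma bw_poly_box_product:
  assumes "simple_graph G" "verts L = {1..Suc k}" "simple_graph L"
  shows "bw_poly (box_product G L) = bw_poly (glued G G L)"
proof -
  let ?f = "\<lambda>p. glue_base (Inr p)"
  have inj: "inj_on ?f (verts (box_product G L))"
    by (auto simp: inj_on_def split: if_splits)
  have edge: "\<exists>u v. e = {u, v} \<and> adj G u v" if "e \<in> edges G" for e
  proof -
    have "card e = 2"
      using assms(1) that by (auto simp: simple_graph_def)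
    then obtain u v where "e = {u, v}"
      by (auto simp: card_2_iff)
    with that show ?thesis
      by (auto simp: adj_def)
  qed
  have glued: "(`) Inl ` edges G \<subseteq>
      {{glue_base (Inr (u, i)), glue_base (Inr (v, i))} | u v i. i \<in> verts L \<and> adj G u v}"
  proof
    fix e :: "('a + 'a \<times> nat) set" assume "e \<in> (`) Inl ` edges G"
    then obtain e' where "e = Inl ` e'" "e' \<in> edges G"
      by blast
    with edge[OF this(2)] obtain u v where "e = {Inl u, Inl v}" "adj G u v"
      by auto
    then have "e = {glue_base (Inr (u, 1)), glue_base (Inr (v, 1))}" "1 \<in> verts L" "adj G u v"
      using assms(2) by auto
    then show "e \<in> {{glue_base (Inr (u, i)), glue_base (Inr (v, i))} | u v i. i \<in> verts L \<and> adj G u v}"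
      by blast
  qed
  have "edges (identify ?f (box_product G L)) =
     {{glue_base (Inr (u, i)), glue_base (Inr (v, i))} | u v i. i \<in> verts L \<and> adj G u v} \<union>
     {{glue_base (Inr (u, i)), glue_base (Inr (u, j))} | u i j. u \<in> verts G \<and> adj L i j}"
    by (simp only: identify_def graph.simps image_edges_box_product)
  also have "\<dots> = edges (glued G G L)"
    using glued unfolding edges_glued by blast
  finally have edges: "edges (identify ?f (box_product G L)) = edges (glued G G L)" .
  have "verts (identify ?f (box_product G L)) = verts (glued G G L)"
  proof -
    have "verts (glued G G L) = Inl ` verts G \<union> ?f ` (verts G \<times> verts L)"
      by (simp add: glued_def identify_def disjoint_union_def box_product_def image_Un image_image)
    moreover have "Inl v \<in> ?f ` (verts G \<times> verts L)" if "v \<in> verts G" for v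
      using that assms(2) by (intro image_eqI[of _ _ "(v, 1)"]) auto
    ultimately show ?thesis
      by (auto simp: identify_def box_product_def simp del: glue_base.simps)
  qed
  with edges have "identify ?f (box_product G L) = glued G G L"
    by (simp add: graph.equality)
  moreover have "finite (verts (box_product G L))"
    using assms by (simp add: box_product_def simple_graph_def)
  moreover have "e \<subseteq> verts (box_product G L)" if "e \<in> edges (box_product G L)" for e
    using that simple_graph_adjD[OF assms(1)] simple_graph_adjD[OF assms(3)]
    by (auto simp: box_product_def)
  ultimately show ?thesis
    using bw_poly_identify[OF _ inj] by metis
qed

section \<open>Layers along a path and along a cycle\<close>

lemma adj_path_graph:
  "adj (path_graph n) i j \<longleftrightarrow> 1 \<le> i \<and> 1 \<le> j \<and> i \<le> n \<and> j \<le> n \<and> (j = i + 1 \<or> i = j + 1)"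
  by (auto simp: adj_def path_graph_def doubleton_eq_iff)

lemma adj_cycle_graph:
  "adj (cycle_graph n) i j \<longleftrightarrow> adj (path_graph n) i j \<or> (i = n \<and> j = 1) \<or> (i = 1 \<and> j = n)"
  by (auto simp: adj_def path_graph_def cycle_graph_def doubleton_eq_iff)

lemma simple_graph_path_graph: "simple_graph (path_graph n)"
  by (auto simp: simple_graph_def path_graph_def)

lemma simple_graph_cycle_graph: "n \<ge> 3 \<Longrightarrow> simple_graph (cycle_graph n)"
  by (auto simp: simple_graph_def cycle_graph_def)

text \<open>The transfer weight of the layer \<open>y\<close> between \<open>x\<close> and
  \<open>z\<close>; in these two layers a vertex meets only its own copies.\<close>

definition layer_weight :: "'a graph \<Rightarrow> ('a \<Rightarrow> nat) \<Rightarrow> ('a \<Rightarrow> nat) \<Rightarrow> ('a \<Rightarrow> nat) \<Rightarrow> int poly" where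
  "layer_weight H x y z = (\<Prod>u\<in>verts H. vertex_weight (y u)
     ((\<Sum>u'\<in>verts H. of_bool (adj H u u') * y u') + (x u + z u)))"

text \<open>Here \<open>pq\<close> is the pair of first and last chain layers. A path leaves the
  base in one direction only; a cycle returns to it, so the last layer counts too.\<close>

definition base_weight ::
    "'a graph \<Rightarrow> 'a graph \<Rightarrow> bool \<Rightarrow> ('a \<Rightarrow> nat) \<Rightarrow> ('a \<Rightarrow> nat) \<times> ('a \<Rightarrow> nat) \<Rightarrow> int poly" where
  "base_weight G H cyc g pq = (\<Prod>v\<in>verts G. vertex_weight (g v)
     ((\<Sum>u\<in>verts G. of_bool (adj G v u) * g u) +
      of_bool (v \<in> verts H) * (fst pq v + of_bool cyc * snd pq v)))"

text \<open>The restriction makes this layer, like all others, an element of the extensional state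
  set.\<close>

definition end_layer :: "'a graph \<Rightarrow> bool \<Rightarrow> ('a \<Rightarrow> nat) \<Rightarrow> 'a \<Rightarrow> nat" where
  "end_layer H cyc g = restrict (\<lambda>u. if cyc then g u else 0) (verts H)"

text \<open>The two assumptions on \<open>L\<close> say that it is a path (\<open>cyc = False\<close>) or a cycle
  (\<open>cyc = True\<close>): a path ends in a further, all-white layer, a cycle in its first layer.\<close>

lemma bw_poly_glued_extend_path:
  assumes "simple_graph G" "subgraph H G" "verts L = {1..Suc k}" "simple_graph L"
    and first: "\<And>f :: nat \<Rightarrow> nat. \<And>a z. z = (if cyc then a else 0) \<Longrightarrow>
      (\<Sum>i=1..k. of_bool (adj L 1 (Suc i)) * f i) =
        extend_path a z k f 1 + of_bool cyc * extend_path a z k f k"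
    and inner: "\<And>f :: nat \<Rightarrow> nat. \<And>a z i. z = (if cyc then a else 0) \<Longrightarrow> i \<in> {1..k} \<Longrightarrow>
      of_bool (adj L (Suc i) 1) * a + (\<Sum>i'=1..k. of_bool (adj L (Suc i) (Suc i')) * f i') =
        extend_path a z k f (i - 1) + extend_path a z k f (i + 1)"
  shows "bw_poly (glued G H L) =
    (\<Sum>g\<in>verts G \<rightarrow>\<^sub>E {0, 1}. \<Sum>y\<in>{1..k} \<rightarrow>\<^sub>E (verts H \<rightarrow>\<^sub>E {0, 1}).
      base_weight G H cyc g
        (extend_path (restrict g (verts H)) (end_layer H cyc g) k y 1,
         extend_path (restrict g (verts H)) (end_layer H cyc g) k y k) *
      path_weight (layer_weight H) k (extend_path (restrict g (verts H)) (end_layer H cyc g) k y))"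
  unfolding bw_poly_glued[OF assms(1-4)]
proof (intro sum.cong refl arg_cong2[where f = "(*)"])
  fix g :: "'a \<Rightarrow> nat" and y
  let ?U = "verts H"
  let ?y = "extend_path (restrict g ?U) (end_layer H cyc g) k y"
  \<comment> \<open>Over one vertex \<open>u\<close>, a chain of layers is a chain of colors. This
    reduces adjacency along \<open>L\<close> to the numerical hypotheses \<open>first\<close> and
    \<open>inner\<close>.\<close>
  have ext: "?y i u = extend_path (g u) (if cyc then g u else 0) k (\<lambda>i. y i u) i" if "u \<in> ?U" for i u
    using that by (simp add: extend_path_def end_layer_def)
  show "(\<Prod>v\<in>verts G. vertex_weight (g v) ((\<Sum>u\<in>verts G. of_bool (adj G v u) * g u) +
      of_bool (v \<in> ?U) * (\<Sum>i=1..k. of_bool (adj L 1 (Suc i)) * y i v))) =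
    base_weight G H cyc g (?y 1, ?y k)"
    unfolding base_weight_def
  proof (intro prod.cong refl arg_cong2[where f = vertex_weight] arg_cong2[where f = "(+)"])
    fix v
    show "of_bool (v \<in> ?U) * (\<Sum>i=1..k. of_bool (adj L 1 (Suc i)) * y i v) =
        of_bool (v \<in> ?U) * (fst (?y 1, ?y k) v + of_bool cyc * snd (?y 1, ?y k) v)"
      using first[OF refl, of "\<lambda>i. y i v" "g v"]
      by (cases "v \<in> ?U") (simp_all only: ext fst_conv snd_conv of_bool_eq mult_zero_left)
  qed
  show "(\<Prod>i=1..k. \<Prod>u\<in>?U. vertex_weight (y i u) ((\<Sum>u'\<in>?U. of_bool (adj H u u') * y i u') +
      (of_bool (adj L (Suc i) 1) * g u + (\<Sum>i'=1..k. of_bool (adj L (Suc i) (Suc i')) * y i' u)))) =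
    path_weight (layer_weight H) k ?y"
    unfolding path_weight_def layer_weight_def
  proof (intro prod.cong refl)
    fix i u assume i: "i \<in> {1..k}" and u: "u \<in> ?U"
    have "?y i = y i"
      using i by (simp add: extend_path_def)
    then show "vertex_weight (y i u) ((\<Sum>u'\<in>?U. of_bool (adj H u u') * y i u') +
        (of_bool (adj L (Suc i) 1) * g u + (\<Sum>i'=1..k. of_bool (adj L (Suc i) (Suc i')) * y i' u))) =
      vertex_weight (?y i u) ((\<Sum>u'\<in>?U. of_bool (adj H u u') * ?y i u') + (?y (i - 1) u + ?y (i + 1) u))"
      by (simp only: inner[OF refl i] ext[OF u])
  qed
qed

text \<open>For \<open>i = 1\<close> the index \<open>i - 1\<close> is 0 and lies outside the range,
  as does \<open>i + 1\<close> for \<open>i = k\<close>. The ends of the chain fill these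
  gaps.\<close>

lemma sum_of_bool_neighbours:
  fixes f :: "nat \<Rightarrow> nat"
  assumes "i \<in> {1..k}"
  shows "(\<Sum>i'=1..k. of_bool (i' = i + 1 \<or> i = i' + 1) * f i') =
    (if i = 1 then 0 else f (i - 1)) + (if i < k then f (i + 1) else 0)"
proof -
  have "(\<Sum>i'=1..k. of_bool (i' = i + 1 \<or> i = i' + 1) * f i') =
      (\<Sum>i'=1..k. (if i' = i - 1 then f (i - 1) else 0) + (if i' = i + 1 then f (i + 1) else 0))"
    using assms by (intro sum.cong) auto
  also have "\<dots> = (if i = 1 then 0 else f (i - 1)) + (if i < k then f (i + 1) else 0)"
    using assms unfolding sum.distrib by auto
  finally show ?thesis .
qed

text \<open>The white layer at the right end adds no black neighbors. The formula includes
  \<open>k = 0\<close>, where this white layer is what the base sees as first layer.\<close>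

lemma bw_poly_glued_path_graph:
  assumes "simple_graph G" "subgraph H G"
  shows "bw_poly (glued G H (path_graph (Suc k))) =
    (\<Sum>g\<in>verts G \<rightarrow>\<^sub>E {0, 1}. \<Sum>y\<in>{1..k} \<rightarrow>\<^sub>E (verts H \<rightarrow>\<^sub>E {0, 1}).
      base_weight G H False g
        (extend_path (restrict g (verts H)) (end_layer H False g) k y 1,
         extend_path (restrict g (verts H)) (end_layer H False g) k y k) *
      path_weight (layer_weight H) k (extend_path (restrict g (verts H)) (end_layer H False g) k y))"
proof (rule bw_poly_glued_extend_path[OF assms])
  fix f :: "nat \<Rightarrow> nat" and a z :: nat
  assume z: "z = (if False then a else 0)"
  have "(\<Sum>i=1..k. of_bool (adj (path_graph (Suc k)) 1 (Suc i)) * f i) =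
      (\<Sum>i=1..k. if i = 1 then f 1 else 0)"
    by (intro sum.cong) (auto simp: adj_path_graph)
  then show "(\<Sum>i=1..k. of_bool (adj (path_graph (Suc k)) 1 (Suc i)) * f i) =
      extend_path a z k f 1 + of_bool False * extend_path a z k f k"
    using z by (auto simp: extend_path_def)
  fix i assume i: "i \<in> {1..k}"
  have "(\<Sum>i'=1..k. of_bool (adj (path_graph (Suc k)) (Suc i) (Suc i')) * f i') =
      (\<Sum>i'=1..k. of_bool (i' = i + 1 \<or> i = i' + 1) * f i')"
    using i by (intro sum.cong) (auto simp: adj_path_graph)
  moreover have "adj (path_graph (Suc k)) (Suc i) 1 \<longleftrightarrow> i = 1"
    using i by (auto simp: adj_path_graph)
  ultimately show "of_bool (adj (path_graph (Suc k)) (Suc i) 1) * a +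
      (\<Sum>i'=1..k. of_bool (adj (path_graph (Suc k)) (Suc i) (Suc i')) * f i') =
      extend_path a z k f (i - 1) + extend_path a z k f (i + 1)"
    unfolding sum_of_bool_neighbours[OF i] using z i by (auto simp: extend_path_def)
qed (simp add: path_graph_def, rule simple_graph_path_graph)

text \<open>The base is both ends of the chain. Two chain layers are required, since a single one
  would be counted twice by the base.\<close>

lemma bw_poly_glued_cycle_graph:
  assumes "simple_graph G" "subgraph H G" "k \<ge> 2"
  shows "bw_poly (glued G H (cycle_graph (Suc k))) =
    (\<Sum>g\<in>verts G \<rightarrow>\<^sub>E {0, 1}. \<Sum>y\<in>{1..k} \<rightarrow>\<^sub>E (verts H \<rightarrow>\<^sub>E {0, 1}).
      base_weight G H True g
        (extend_path (restrict g (verts H)) (end_layer H True g) k y 1,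
         extend_path (restrict g (verts H)) (end_layer H True g) k y k) *
      path_weight (layer_weight H) k (extend_path (restrict g (verts H)) (end_layer H True g) k y))"
proof (rule bw_poly_glued_extend_path[OF assms(1,2)])
  show "simple_graph (cycle_graph (Suc k))"
    using assms(3) by (intro simple_graph_cycle_graph) simp
  fix f :: "nat \<Rightarrow> nat" and a z :: nat
  assume z: "z = (if True then a else 0)"
  have "(\<Sum>i=1..k. of_bool (adj (cycle_graph (Suc k)) 1 (Suc i)) * f i) =
      (\<Sum>i=1..k. (if i = 1 then f 1 else 0) + (if i = k then f k else 0))"
    using assms(3) by (intro sum.cong) (auto simp: adj_cycle_graph adj_path_graph)
  then show "(\<Sum>i=1..k. of_bool (adj (cycle_graph (Suc k)) 1 (Suc i)) * f i) =
      extend_path a z k f 1 + of_bool True * extend_path a z k f k"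
    using assms(3) by (auto simp: extend_path_def sum.distrib)
  fix i assume i: "i \<in> {1..k}"
  have "(\<Sum>i'=1..k. of_bool (adj (cycle_graph (Suc k)) (Suc i) (Suc i')) * f i') =
      (\<Sum>i'=1..k. of_bool (i' = i + 1 \<or> i = i' + 1) * f i')"
    using i by (intro sum.cong) (auto simp: adj_cycle_graph adj_path_graph)
  moreover have "adj (cycle_graph (Suc k)) (Suc i) 1 \<longleftrightarrow> i = 1 \<or> i = k"
    using i by (auto simp: adj_cycle_graph adj_path_graph)
  ultimately show "of_bool (adj (cycle_graph (Suc k)) (Suc i) 1) * a +
      (\<Sum>i'=1..k. of_bool (adj (cycle_graph (Suc k)) (Suc i) (Suc i')) * f i') =
      extend_path a z k f (i - 1) + extend_path a z k f (i + 1)"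
    unfolding sum_of_bool_neighbours[OF i] using z i assms(3) by (auto simp: extend_path_def)
qed (auto simp: cycle_graph_def)

text \<open>For fixed \<open>g\<close>, the factor outside the chain depends on \<open>k\<close>
  only through the first and last color. Grouping by this pair leaves finitely many path sums with
  coefficients independent of \<open>k\<close>.\<close>

lemma rational_fps_sum_paths:
  fixes w :: "'s \<Rightarrow> 's \<Rightarrow> 's \<Rightarrow> 'a::idom"
  assumes "finite S" "\<And>g. g \<in> C \<Longrightarrow> a g \<in> S" "\<And>g. g \<in> C \<Longrightarrow> z g \<in> S"
  shows "rational_fps (Abs_fps (\<lambda>k. \<Sum>g\<in>C. \<Sum>y\<in>{1..k} \<rightarrow>\<^sub>E S.
    \<Phi> g (extend_path (a g) (z g) k y 1, extend_path (a g) (z g) k y k) *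
    path_weight w k (extend_path (a g) (z g) k y)))"
proof (rule rational_fps_Abs_fps_sum)
  fix g assume g: "g \<in> C"
  let ?y = "\<lambda>k. extend_path (a g) (z g) k"
  have "(\<Sum>y\<in>{1..k} \<rightarrow>\<^sub>E S. \<Phi> g (?y k y 1, ?y k y k) * path_weight w k (?y k y)) =
      (\<Sum>pq\<in>S \<times> S. \<Phi> g pq * path_sum w S k (a g) (z g) pq)" for k
  proof -
    have "(\<Sum>y\<in>{1..k} \<rightarrow>\<^sub>E S. \<Phi> g (?y k y 1, ?y k y k) * path_weight w k (?y k y)) =
      (\<Sum>pq\<in>S \<times> S. \<Sum>y | y \<in> {1..k} \<rightarrow>\<^sub>E S \<and> (?y k y 1, ?y k y k) = pq.
        \<Phi> g (?y k y 1, ?y k y k) * path_weight w k (?y k y))"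
    proof (rule sum.group[symmetric])
      show "(\<lambda>y. (?y k y 1, ?y k y k)) ` ({1..k} \<rightarrow>\<^sub>E S) \<subseteq> S \<times> S"
        using assms(2,3)[OF g] by (auto simp: extend_path_def PiE_def)
    qed (use assms(1) in \<open>simp_all add: finite_PiE\<close>)
    also have "\<dots> = (\<Sum>pq\<in>S \<times> S. \<Phi> g pq * path_sum w S k (a g) (z g) pq)"
      unfolding path_sum_def sum_distrib_left by (intro sum.cong) auto
    finally show ?thesis .
  qed
  then show "rational_fps (Abs_fps (\<lambda>k. \<Sum>y\<in>{1..k} \<rightarrow>\<^sub>E S.
      \<Phi> g (?y k y 1, ?y k y k) * path_weight w k (?y k y)))"
    using assms g
    by (auto intro!: rational_fps_Abs_fps_sum rational_fps_Abs_fps_mult_left rational_fps_path_sum)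
qed

lemma rational_family_glued:
  fixes G H :: "'a graph"
  assumes "simple_graph G" "subgraph H G"
  shows "(\<And>n. n \<ge> 1 \<Longrightarrow> bw_poly (K n) = bw_poly (glued G H (path_graph n))) \<Longrightarrow>
      rational_family (family_from 1 K)" (is "PROP ?path")
    and "(\<And>n. n \<ge> 3 \<Longrightarrow> bw_poly (K n) = bw_poly (glued G H (cycle_graph n))) \<Longrightarrow>
      rational_family (family_from 3 K)" (is "PROP ?cycle")
proof -
  let ?y = "\<lambda>cyc g. extend_path (restrict g (verts H)) (end_layer H cyc g)"
  let ?a = "\<lambda>cyc k. \<Sum>g\<in>verts G \<rightarrow>\<^sub>E {0, 1}. \<Sum>y\<in>{1..k} \<rightarrow>\<^sub>E (verts H \<rightarrow>\<^sub>E {0, 1}).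
      base_weight G H cyc g (?y cyc g k y 1, ?y cyc g k y k) * path_weight (layer_weight H) k (?y cyc g k y)"
  have UV: "verts H \<subseteq> verts G" and fin: "finite (verts H)"
    using assms(2) by (auto simp: subgraph_def simple_graph_def)
  have "rational_fps (Abs_fps (?a cyc))" for cyc
  proof (rule rational_fps_sum_paths)
    show "finite (verts H \<rightarrow>\<^sub>E {0, 1 :: nat})"
      using fin by (simp add: finite_PiE)
    fix g :: "'a \<Rightarrow> nat" assume g: "g \<in> verts G \<rightarrow>\<^sub>E {0, 1}"
    show "restrict g (verts H) \<in> verts H \<rightarrow>\<^sub>E {0, 1}"
      "end_layer H cyc g \<in> verts H \<rightarrow>\<^sub>E {0, 1}"
      using g UV unfolding end_layer_def restrict_PiE_iff by (auto simp: PiE_def Pi_def)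
  qed
  \<comment> \<open>Of \<open>n\<close> layers, \<open>n - 1\<close> form the chain.\<close>
  then have rat: "rational_fps (Abs_fps (\<lambda>n. ?a cyc (n - 1)))" for cyc
    by (rule rational_fps_Abs_fps_shift)
  show "PROP ?path"
  proof (rule rational_family_family_from[OF rat])
    assume K: "\<And>n. n \<ge> 1 \<Longrightarrow> bw_poly (K n) = bw_poly (glued G H (path_graph n))"
    fix n :: nat assume "n \<ge> 1"
    then show "bw_poly (K n) = ?a False (n - 1)"
      using K[of n] bw_poly_glued_path_graph[OF assms, of "n - 1"] by simp
  qed
  show "PROP ?cycle"
  proof (rule rational_family_family_from[OF rat])
    assume K: "\<And>n. n \<ge> 3 \<Longrightarrow> bw_poly (K n) = bw_poly (glued G H (cycle_graph n))"
    fix n :: nat assume "n \<ge> 3"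
    then show "bw_poly (K n) = ?a True (n - 1)"
      using K[of n] bw_poly_glued_cycle_graph[OF assms, of "n - 1"] by simp
  qed
qed

subsection \<open>Subdivisions\<close>

lemma endpoints_edge:
  assumes "simple_graph G" "e \<in> edges G"
  shows "e = {fst (endpoints e), snd (endpoints e)}"
    and "fst (endpoints e) \<noteq> snd (endpoints e)"
    and "fst (endpoints e) \<in> verts G" "snd (endpoints e) \<in> verts G"
proof -
  have e: "card e = 2" "e \<subseteq> verts G"
    using assms by (auto simp: simple_graph_def)
  then obtain u v where "e = {u, v}"
    by (auto simp: card_2_iff)
  then have "e = {fst (u, v), snd (u, v)}"
    by simp
  then show *: "e = {fst (endpoints e), snd (endpoints e)}"
    unfolding endpoints_def by (rule someI)
  show "fst (endpoints e) \<noteq> snd (endpoints e)"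
  proof
    assume "fst (endpoints e) = snd (endpoints e)"
    with * have "card e = card {snd (endpoints e)}"
      by simp
    with e show False
      by simp
  qed
  show "fst (endpoints e) \<in> verts G" "snd (endpoints e) \<in> verts G"
    using e(2) * by blast+
qed

lemma verts_subdivide: "verts (subdivide G \<nu>) = verts G <+> Sigma (edges G) (\<lambda>e. {1..\<nu> e})"
  by (auto simp: subdivide_def)

lemma adj_subdivide:
  assumes "simple_graph G"
  shows "adj (subdivide G \<nu>) (Inl v) (Inl u) \<longleftrightarrow> {v, u} \<in> edges G \<and> \<nu> {v, u} = 0"
    and "e \<in> edges G \<Longrightarrow> i \<in> {1..\<nu> e} \<Longrightarrow> adj (subdivide G \<nu>) (Inl v) (Inr (e, i)) \<longleftrightarrow>
      i = 1 \<and> v = fst (endpoints e) \<or> i = \<nu> e \<and> v = snd (endpoints e)"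
    and "e \<in> edges G \<Longrightarrow> i \<in> {1..\<nu> e} \<Longrightarrow> j \<in> {1..\<nu> e'} \<Longrightarrow>
      adj (subdivide G \<nu>) (Inr (e, i)) (Inr (e', j)) \<longleftrightarrow> e = e' \<and> (j = i + 1 \<or> i = j + 1)"
proof -
  have edge: "{x, y} \<in> edges (subdivide G \<nu>) \<longleftrightarrow> (\<exists>e k. e \<in> edges G \<and> k \<le> \<nu> e \<and>
      (x = subdiv_vertex (\<nu> e) e k \<and> y = subdiv_vertex (\<nu> e) e (k + 1) \<or>
       x = subdiv_vertex (\<nu> e) e (k + 1) \<and> y = subdiv_vertex (\<nu> e) e k))" for x y
    by (auto simp: subdivide_def doubleton_eq_iff)
  show "adj (subdivide G \<nu>) (Inl v) (Inl u) \<longleftrightarrow> {v, u} \<in> edges G \<and> \<nu> {v, u} = 0"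
  proof
    assume "adj (subdivide G \<nu>) (Inl v) (Inl u)"
    then obtain e k where e: "e \<in> edges G" "k \<le> \<nu> e"
      and k: "Inl v = subdiv_vertex (\<nu> e) e k \<and> Inl u = subdiv_vertex (\<nu> e) e (k + 1) \<or>
        Inl v = subdiv_vertex (\<nu> e) e (k + 1) \<and> Inl u = subdiv_vertex (\<nu> e) e k"
      unfolding adj_def edge by blast
    \<comment> \<open>Two base vertices are consecutive on the path replacing \<open>e\<close> only
      if that path has no interior vertex.\<close>
    from k e(2) have "\<nu> e = 0" "{v, u} = {fst (endpoints e), snd (endpoints e)}"
      by (auto simp: subdiv_vertex_def split: if_splits)
    then show "{v, u} \<in> edges G \<and> \<nu> {v, u} = 0"
      using endpoints_edge(1)[OF assms e(1)] e(1) by metis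
  next
    assume *: "{v, u} \<in> edges G \<and> \<nu> {v, u} = 0"
    then have "{v, u} = {fst (endpoints {v, u}), snd (endpoints {v, u})}"
      using endpoints_edge(1)[OF assms] by blast
    then have "v = fst (endpoints {v, u}) \<and> u = snd (endpoints {v, u}) \<or>
        v = snd (endpoints {v, u}) \<and> u = fst (endpoints {v, u})"
      unfolding doubleton_eq_iff by blast
    with * show "adj (subdivide G \<nu>) (Inl v) (Inl u)"
      unfolding adj_def edge
      by (intro exI[of _ "{v, u}"] exI[of _ 0]) (auto simp: subdiv_vertex_def)
  qed
  show "adj (subdivide G \<nu>) (Inl v) (Inr (e, i)) \<longleftrightarrow>
      i = 1 \<and> v = fst (endpoints e) \<or> i = \<nu> e \<and> v = snd (endpoints e)"
    if "e \<in> edges G" "i \<in> {1..\<nu> e}" for e i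
  proof
    assume "adj (subdivide G \<nu>) (Inl v) (Inr (e, i))"
    then show "i = 1 \<and> v = fst (endpoints e) \<or> i = \<nu> e \<and> v = snd (endpoints e)"
      using that unfolding adj_def edge by (auto simp: subdiv_vertex_def split: if_splits)
  next
    assume "i = 1 \<and> v = fst (endpoints e) \<or> i = \<nu> e \<and> v = snd (endpoints e)"
    then show "adj (subdivide G \<nu>) (Inl v) (Inr (e, i))"
    proof
      assume "i = 1 \<and> v = fst (endpoints e)"
      then show ?thesis
        using that unfolding adj_def edge
        by (intro exI[of _ e] exI[of _ 0]) (auto simp: subdiv_vertex_def)
    next
      assume "i = \<nu> e \<and> v = snd (endpoints e)"
      then show ?thesis
        using that unfolding adj_def edge
        by (intro exI[of _ e] exI[of _ i]) (auto simp: subdiv_vertex_def)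
    qed
  qed
  show "adj (subdivide G \<nu>) (Inr (e, i)) (Inr (e', j)) \<longleftrightarrow> e = e' \<and> (j = i + 1 \<or> i = j + 1)"
    if "e \<in> edges G" "i \<in> {1..\<nu> e}" "j \<in> {1..\<nu> e'}" for e e' i j
  proof
    assume "adj (subdivide G \<nu>) (Inr (e, i)) (Inr (e', j))"
    then show "e = e' \<and> (j = i + 1 \<or> i = j + 1)"
      using that unfolding adj_def edge by (auto simp: subdiv_vertex_def split: if_splits)
  next
    assume "e = e' \<and> (j = i + 1 \<or> i = j + 1)"
    \<comment> \<open>The edge between positions \<open>i\<close> and \<open>j\<close> is indexed by
      the smaller one.\<close>
    then show "adj (subdivide G \<nu>) (Inr (e, i)) (Inr (e', j))"
      using that unfolding adj_def edge
      by (intro exI[of _ e] exI[of _ "min i j"]) (auto simp: subdiv_vertex_def)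
  qed
qed

definition edge_weight :: "nat \<Rightarrow> nat \<Rightarrow> nat \<Rightarrow> int poly" where
  "edge_weight a b c = vertex_weight b (a + c)"

text \<open>The adjacency of \<open>G\<close> does not occur: every edge, subdivided or not, acts
  through the colors that its two endpoints see along it.\<close>

definition branch_weight :: "'a graph \<Rightarrow> ('a \<Rightarrow> nat) \<Rightarrow> ('a set \<Rightarrow> nat \<times> nat) \<Rightarrow> int poly" where
  "branch_weight G g pq = (\<Prod>v\<in>verts G. vertex_weight (g v)
     (\<Sum>e\<in>edges G. of_bool (v = fst (endpoints e)) * fst (pq e) + of_bool (v = snd (endpoints e)) * snd (pq e)))"

abbreviation edge_path :: "('a \<Rightarrow> nat) \<Rightarrow> ('a set \<Rightarrow> nat) \<Rightarrow> ('a set \<Rightarrow> nat \<Rightarrow> nat) \<Rightarrow> 'a set \<Rightarrow> nat \<Rightarrow> nat" where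
  "edge_path g \<nu> y e \<equiv> extend_path (g (fst (endpoints e))) (g (snd (endpoints e))) (\<nu> e) (y e)"

lemma finite_edges: "simple_graph G \<Longrightarrow> finite (edges G)"
  by (rule finite_subset[of _ "Pow (verts G)"]) (auto simp: simple_graph_def)

text \<open>Every edge of \<open>G\<close> is treated as a chain, possibly empty. An empty chain
  shows each endpoint the color of the other, just as an ordinary edge does, so the formula needs no
  case distinction.\<close>

lemma bw_poly_subdivide:
  assumes "simple_graph G"
  shows "bw_poly (subdivide G \<nu>) =
    (\<Sum>g\<in>verts G \<rightarrow>\<^sub>E {0, 1}. \<Sum>y\<in>PiE (edges G) (\<lambda>e. {1..\<nu> e} \<rightarrow>\<^sub>E {0, 1}).
      branch_weight G g (\<lambda>e\<in>edges G. (edge_path g \<nu> y e 1, edge_path g \<nu> y e (\<nu> e))) *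
      (\<Prod>e\<in>edges G. path_weight edge_weight (\<nu> e) (edge_path g \<nu> y e)))"
    (is "_ = (\<Sum>g\<in>_. \<Sum>y\<in>_. ?A g y * ?B g y)")
proof -
  let ?V = "verts G" and ?E = "edges G" and ?K = "subdivide G \<nu>"
  let ?s = "\<lambda>e. fst (endpoints e)" and ?t = "\<lambda>e. snd (endpoints e)"
  let ?S = "Sigma ?E (\<lambda>e. {1..\<nu> e})"
  have fin: "finite ?V" "finite ?E"
    using assms finite_edges by (auto simp: simple_graph_def)
  then have finS: "finite ?S"
    by simp
  note ends = endpoints_edge[OF assms]
  note adj = adj_subdivide[OF assms, where \<nu> = \<nu>]
  have sumS: "(\<Sum>b\<in>?S. f b) = (\<Sum>e\<in>?E. \<Sum>i=1..\<nu> e. f (e, i))" for f :: "'a set \<times> nat \<Rightarrow> nat"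
    using fin(2) by (simp add: sum.Sigma)
  have prodS: "(\<Prod>b\<in>?S. f b) = (\<Prod>e\<in>?E. \<Prod>i=1..\<nu> e. f (e, i))" for f :: "'a set \<times> nat \<Rightarrow> int poly"
    using fin(2) by (simp add: prod.Sigma)
  have base: "(\<Sum>u\<in>?V. of_bool (adj ?K (Inl v) (Inl u)) * g u) +
      (\<Sum>b\<in>?S. of_bool (adj ?K (Inl v) (Inr b)) * x b) =
    (\<Sum>e\<in>?E. of_bool (v = ?s e) * edge_path g \<nu> (curry x) e 1 +
      of_bool (v = ?t e) * edge_path g \<nu> (curry x) e (\<nu> e))" for v g x
  proof -
    \<comment> \<open>Sorting the base neighbors of \<open>v\<close> by the edge that leads to them
      turns both kinds of neighbors into sums over edges.\<close>
    have "(\<Sum>u\<in>?V. of_bool (adj ?K (Inl v) (Inl u)) * g u) =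
        (\<Sum>u\<in>?V. \<Sum>e\<in>?E. if e = {v, u} then of_bool (\<nu> {v, u} = 0) * g u else 0)"
      using fin(2) by (intro sum.cong) (auto simp: adj(1))
    also have "\<dots> = (\<Sum>e\<in>?E. \<Sum>u\<in>?V. if e = {v, u} then of_bool (\<nu> {v, u} = 0) * g u else 0)"
      by (rule sum.swap)
    finally have 1: "(\<Sum>u\<in>?V. of_bool (adj ?K (Inl v) (Inl u)) * g u) = \<dots>" .
    have "(\<Sum>u\<in>?V. if e = {v, u} then of_bool (\<nu> {v, u} = 0) * g u else 0) +
        (\<Sum>i=1..\<nu> e. of_bool (adj ?K (Inl v) (Inr (e, i))) * x (e, i)) =
        of_bool (v = ?s e) * edge_path g \<nu> (curry x) e 1 +
        of_bool (v = ?t e) * edge_path g \<nu> (curry x) e (\<nu> e)" if e: "e \<in> ?E" for e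
    proof (cases "\<nu> e = 0")
      case True
      have "(\<Sum>u\<in>?V. if e = {v, u} then of_bool (\<nu> {v, u} = 0) * g u else 0) =
          (\<Sum>u\<in>?V. (if u = ?t e then of_bool (v = ?s e) * g (?t e) else 0) +
            (if u = ?s e then of_bool (v = ?t e) * g (?s e) else 0))"
      proof (rule sum.cong[OF refl])
        fix u
        have "e = {v, u} \<longleftrightarrow> v = ?s e \<and> u = ?t e \<or> v = ?t e \<and> u = ?s e"
          using ends(1)[OF e] by (metis doubleton_eq_iff)
        then show "(if e = {v, u} then of_bool (\<nu> {v, u} = 0) * g u else 0) =
            (if u = ?t e then of_bool (v = ?s e) * g (?t e) else 0) +
            (if u = ?s e then of_bool (v = ?t e) * g (?s e) else 0)"
          using True ends(2)[OF e] by (cases "e = {v, u}") auto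
      qed
      also have "\<dots> = of_bool (v = ?s e) * g (?t e) + of_bool (v = ?t e) * g (?s e)"
        using fin(1) ends(3,4)[OF e] by (simp add: sum.distrib)
      finally show ?thesis
        using True by (simp add: extend_path_def)
    next
      case False
      \<comment> \<open>For a single new vertex \<open>i = 1\<close> and \<open>i = \<nu> e\<close>
        coincide; as the endpoints are distinct, \<open>v\<close> is at most one of them and nothing
        is counted twice.\<close>
      have "(\<Sum>i=1..\<nu> e. of_bool (adj ?K (Inl v) (Inr (e, i))) * x (e, i)) =
          (\<Sum>i=1..\<nu> e. (if i = 1 then of_bool (v = ?s e) * x (e, 1) else 0) +
            (if i = \<nu> e then of_bool (v = ?t e) * x (e, \<nu> e) else 0))"
        using ends(2)[OF e] by (intro sum.cong) (auto simp: adj(2)[OF e])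
      also have "\<dots> = of_bool (v = ?s e) * x (e, 1) + of_bool (v = ?t e) * x (e, \<nu> e)"
        using False by (simp add: sum.distrib)
      finally have "(\<Sum>i=1..\<nu> e. of_bool (adj ?K (Inl v) (Inr (e, i))) * x (e, i)) = \<dots>" .
      moreover have "(\<Sum>u\<in>?V. if e = {v, u} then of_bool (\<nu> {v, u} = 0) * g u else 0) = 0"
        using False by (intro sum.neutral) auto
      ultimately show ?thesis
        using False by (simp add: extend_path_def)
    qed
    then show ?thesis
      unfolding 1 sumS sum.distrib[symmetric] by (intro sum.cong) auto
  qed
  have inner: "(\<Sum>u\<in>?V. of_bool (adj ?K (Inr (e, i)) (Inl u)) * g u) +
      (\<Sum>b\<in>?S. of_bool (adj ?K (Inr (e, i)) (Inr b)) * x b) =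
    edge_path g \<nu> (curry x) e (i - 1) + edge_path g \<nu> (curry x) e (i + 1)"
    if e: "e \<in> ?E" and i: "i \<in> {1..\<nu> e}" for e i g x
  proof -
    \<comment> \<open>A lone new vertex is adjacent to both endpoints; these are distinct, so each
      \<open>u\<close> matches at most one summand.\<close>
    have "(\<Sum>u\<in>?V. of_bool (adj ?K (Inr (e, i)) (Inl u)) * g u) =
        (\<Sum>u\<in>?V. (if u = ?s e then of_bool (i = 1) * g (?s e) else 0) +
          (if u = ?t e then of_bool (i = \<nu> e) * g (?t e) else 0))"
      using ends(2)[OF e] by (intro sum.cong) (auto simp: adj_commute[of _ "Inr _"] adj(2)[OF e i])
    also have "\<dots> = of_bool (i = 1) * g (?s e) + of_bool (i = \<nu> e) * g (?t e)"
      using fin(1) ends(3,4)[OF e] by (simp add: sum.distrib)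
    finally have 1: "(\<Sum>u\<in>?V. of_bool (adj ?K (Inr (e, i)) (Inl u)) * g u) = \<dots>" .
    have "(\<Sum>b\<in>?S. of_bool (adj ?K (Inr (e, i)) (Inr b)) * x b) =
        (\<Sum>e'\<in>?E. if e' = e then \<Sum>j=1..\<nu> e. of_bool (j = i + 1 \<or> i = j + 1) * x (e, j) else 0)"
      unfolding sumS
    proof (rule sum.cong[OF refl])
      fix e'
      have "(\<Sum>j=1..\<nu> e'. of_bool (adj ?K (Inr (e, i)) (Inr (e', j))) * x (e', j)) =
          (\<Sum>j=1..\<nu> e'. of_bool (e = e' \<and> (j = i + 1 \<or> i = j + 1)) * x (e', j))"
        by (intro sum.cong refl) (simp only: adj(3)[OF e i])
      then show "(\<Sum>j=1..\<nu> e'. of_bool (adj ?K (Inr (e, i)) (Inr (e', j))) * x (e', j)) =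
          (if e' = e then \<Sum>j=1..\<nu> e. of_bool (j = i + 1 \<or> i = j + 1) * x (e, j) else 0)"
        by (cases "e' = e") (simp_all del: of_bool_or_iff)
    qed
    also have "\<dots> = (\<Sum>j=1..\<nu> e. of_bool (j = i + 1 \<or> i = j + 1) * x (e, j))"
      using e fin(2) by simp
    finally show ?thesis
      unfolding 1 sum_of_bool_neighbours[OF i] using i by (auto simp: extend_path_def)
  qed
  have "bw_poly ?K = (\<Sum>g\<in>?V \<rightarrow>\<^sub>E {0, 1}. \<Sum>x\<in>?S \<rightarrow>\<^sub>E {0, 1}. ?A g (curry x) * ?B g (curry x))"
    unfolding bw_poly_Plus[OF fin(1) finS verts_subdivide] base
  proof (intro sum.cong refl arg_cong2[where f = "(*)"])
    fix g :: "'a \<Rightarrow> nat" and x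
    show "(\<Prod>v\<in>?V. vertex_weight (g v) (\<Sum>e\<in>?E. of_bool (v = ?s e) * edge_path g \<nu> (curry x) e 1 +
        of_bool (v = ?t e) * edge_path g \<nu> (curry x) e (\<nu> e))) = ?A g (curry x)"
      unfolding branch_weight_def
      by (intro prod.cong refl arg_cong2[where f = vertex_weight] sum.cong) simp
    show "(\<Prod>b\<in>?S. vertex_weight (x b) ((\<Sum>u\<in>?V. of_bool (adj ?K (Inr b) (Inl u)) * g u) +
        (\<Sum>b'\<in>?S. of_bool (adj ?K (Inr b) (Inr b')) * x b'))) = ?B g (curry x)"
      unfolding prodS path_weight_def edge_weight_def
      by (intro prod.cong refl arg_cong2[where f = vertex_weight])
        (simp_all only: inner, simp add: extend_path_def)
  qed
  also have "\<dots> = (\<Sum>g\<in>?V \<rightarrow>\<^sub>E {0, 1}. \<Sum>y\<in>PiE ?E (\<lambda>e. {1..\<nu> e} \<rightarrow>\<^sub>E {0, 1}). ?A g y * ?B g y)"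
  proof (intro sum.cong refl)
    fix g
    show "(\<Sum>x\<in>?S \<rightarrow>\<^sub>E {0, 1}. ?A g (curry x) * ?B g (curry x)) =
        (\<Sum>y\<in>PiE ?E (\<lambda>e. {1..\<nu> e} \<rightarrow>\<^sub>E {0, 1}). ?A g y * ?B g y)"
    proof (rule sum.reindex_bij_witness[of _
          "\<lambda>y. restrict (\<lambda>(e, i). y e i) ?S" "\<lambda>x. \<lambda>e\<in>?E. \<lambda>i\<in>{1..\<nu> e}. x (e, i)"])
      fix x assume x: "x \<in> ?S \<rightarrow>\<^sub>E {0, 1 :: nat}"
      show "restrict (\<lambda>(e, i). (\<lambda>e\<in>?E. \<lambda>i\<in>{1..\<nu> e}. x (e, i)) e i) ?S = x"
        using x by (auto simp: fun_eq_iff PiE_def extensional_def)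
      show "(\<lambda>e\<in>?E. \<lambda>i\<in>{1..\<nu> e}. x (e, i)) \<in> PiE ?E (\<lambda>e. {1..\<nu> e} \<rightarrow>\<^sub>E {0, 1})"
        using x by (auto simp: PiE_def Pi_def)
      have "edge_path g \<nu> (\<lambda>e\<in>?E. \<lambda>i\<in>{1..\<nu> e}. x (e, i)) e = edge_path g \<nu> (curry x) e"
        if "e \<in> ?E" for e
        using that by (auto simp: extend_path_def fun_eq_iff)
      then show "?A g (\<lambda>e\<in>?E. \<lambda>i\<in>{1..\<nu> e}. x (e, i)) * ?B g (\<lambda>e\<in>?E. \<lambda>i\<in>{1..\<nu> e}. x (e, i)) =
          ?A g (curry x) * ?B g (curry x)"
        by (simp cong: restrict_cong prod.cong)
    next
      fix y assume y: "y \<in> PiE ?E (\<lambda>e. {1..\<nu> e} \<rightarrow>\<^sub>E {0, 1 :: nat})"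
      show "(\<lambda>e\<in>?E. \<lambda>i\<in>{1..\<nu> e}. restrict (\<lambda>(e, i). y e i) ?S (e, i)) = y"
        using y by (fastforce simp: fun_eq_iff PiE_def Pi_def extensional_def)
      have *: "y e i \<in> {0, 1}" if "e \<in> ?E" "i \<in> {1..\<nu> e}" for e i
        by (rule PiE_mem[OF PiE_mem[OF y that(1)] that(2)])
      show "restrict (\<lambda>(e, i). y e i) ?S \<in> ?S \<rightarrow>\<^sub>E {0, 1}"
        unfolding restrict_PiE_iff by (intro ballI, elim SigmaE, simp only: prod.case *)
    qed
  qed
  finally show ?thesis .
qed

text \<open>The chains are coupled only through their boundary data \<open>h\<close>. Once these are
  fixed, the chains vary independently, and the sum over the product set becomes a product of
  sums.\<close>

lemma sum_PiE_group:
  fixes f :: "'i \<Rightarrow> 'b \<Rightarrow> 'r::comm_semiring_1"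
  assumes "finite I" "\<And>i. i \<in> I \<Longrightarrow> finite (T i)" "\<And>i. i \<in> I \<Longrightarrow> finite (S i)"
    and "\<And>i. i \<in> I \<Longrightarrow> h i ` T i \<subseteq> S i"
  shows "(\<Sum>y\<in>PiE I T. \<Phi> (\<lambda>i\<in>I. h i (y i)) * (\<Prod>i\<in>I. f i (y i))) =
    (\<Sum>z\<in>PiE I S. \<Phi> z * (\<Prod>i\<in>I. \<Sum>y | y \<in> T i \<and> h i y = z i. f i y))"
proof -
  let ?h = "\<lambda>y. \<lambda>i\<in>I. h i (y i)"
  have "(\<Sum>y\<in>PiE I T. \<Phi> (?h y) * (\<Prod>i\<in>I. f i (y i))) =
      (\<Sum>z\<in>PiE I S. \<Sum>y | y \<in> PiE I T \<and> ?h y = z. \<Phi> (?h y) * (\<Prod>i\<in>I. f i (y i)))"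
  proof (rule sum.group[symmetric])
    show "?h ` PiE I T \<subseteq> PiE I S"
      using assms(4) by (auto simp: PiE_def Pi_def image_subset_iff)
  qed (use assms in \<open>simp_all add: finite_PiE\<close>)
  also have "\<dots> = (\<Sum>z\<in>PiE I S. \<Phi> z * (\<Sum>y\<in>PiE I (\<lambda>i. {y \<in> T i. h i y = z i}). \<Prod>i\<in>I. f i (y i)))"
  proof (rule sum.cong[OF refl])
    fix z assume z: "z \<in> PiE I S"
    have "{y \<in> PiE I T. ?h y = z} = PiE I (\<lambda>i. {y \<in> T i. h i y = z i})"
      using z by (auto simp: PiE_def Pi_def extensional_def fun_eq_iff restrict_def)
    moreover have "(\<Sum>y | y \<in> PiE I T \<and> ?h y = z. \<Phi> (?h y) * (\<Prod>i\<in>I. f i (y i))) =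
        \<Phi> z * (\<Sum>y | y \<in> PiE I T \<and> ?h y = z. \<Prod>i\<in>I. f i (y i))"
      by (simp add: sum_distrib_left)
    ultimately show "(\<Sum>y | y \<in> PiE I T \<and> ?h y = z. \<Phi> (?h y) * (\<Prod>i\<in>I. f i (y i))) =
        \<Phi> z * (\<Sum>y\<in>PiE I (\<lambda>i. {y \<in> T i. h i y = z i}). \<Prod>i\<in>I. f i (y i))"
      by simp
  qed
  also have "\<dots> = (\<Sum>z\<in>PiE I S. \<Phi> z * (\<Prod>i\<in>I. \<Sum>y | y \<in> T i \<and> h i y = z i. f i y))"
    using assms by (subst prod_sum_PiE) auto
  finally show ?thesis .
qed

text \<open>With the length \<open>i\<close> of \<open>e\<close> split off, a tuple on
  \<open>F\<close> with sum \<open>n - i\<close> remains. Its entry at \<open>e\<close> is reset to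
  0 because tuples vanish outside their index set.\<close>

lemma sum_tuples_insert:
  assumes "finite F" "e \<notin> F"
  shows "(\<Sum>\<nu>\<in>tuples (insert e F) n. f \<nu>) = (\<Sum>i=0..n. \<Sum>\<nu>\<in>tuples F (n - i). f (\<nu>(e := i)))"
proof -
  have "(\<Sum>\<nu>\<in>tuples (insert e F) n. f \<nu>) = (\<Sum>(i, \<nu>)\<in>Sigma {0..n} (\<lambda>i. tuples F (n - i)). f (\<nu>(e := i)))"
  proof (rule sum.reindex_bij_witness[of _ "\<lambda>(i, \<nu>). \<nu>(e := i)" "\<lambda>\<nu>. (\<nu> e, \<nu>(e := 0))"])
    fix \<nu> assume \<nu>: "\<nu> \<in> tuples (insert e F) n"
    have "(\<Sum>x\<in>F. (\<nu>(e := 0)) x) = (\<Sum>x\<in>F. \<nu> x)"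
      using assms(2) by (intro sum.cong) auto
    then show "(\<nu> e, \<nu>(e := 0)) \<in> Sigma {0..n} (\<lambda>i. tuples F (n - i))"
      using \<nu> assms by (auto simp: tuples_def)
  next
    fix p :: "nat \<times> ('a set \<Rightarrow> nat)"
    assume "p \<in> Sigma {0..n} (\<lambda>i. tuples F (n - i))"
    then obtain i \<nu> where p: "p = (i, \<nu>)" "i \<le> n" "\<nu> \<in> tuples F (n - i)"
      by auto
    have "(\<Sum>x\<in>F. (\<nu>(e := i)) x) = (\<Sum>x\<in>F. \<nu> x)"
      using assms(2) by (intro sum.cong) auto
    then show "(case p of (i, \<nu>) \<Rightarrow> \<nu>(e := i)) \<in> tuples (insert e F) n"
      using p assms by (auto simp: tuples_def)
    have "\<nu> e = 0"
      using p(3) assms(2) by (simp add: tuples_def)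
    then show "(\<lambda>\<nu>. (\<nu> e, \<nu>(e := 0))) (case p of (i, \<nu>) \<Rightarrow> \<nu>(e := i)) = p"
      using p(1) by auto
  qed auto
  also have "\<dots> = (\<Sum>i=0..n. \<Sum>\<nu>\<in>tuples F (n - i). f (\<nu>(e := i)))"
    using assms(1) by (simp add: sum.Sigma finite_tuples)
  finally show ?thesis .
qed

text \<open>Distributing \<open>n\<close> among the edges is the convolution of the Cauchy product,
  with one factor per edge.\<close>

lemma Abs_fps_sum_tuples:
  fixes f :: "'a set \<Rightarrow> nat \<Rightarrow> 'r::comm_ring_1"
  assumes "finite F"
  shows "Abs_fps (\<lambda>n. \<Sum>\<nu>\<in>tuples F n. \<Prod>e\<in>F. f e (\<nu> e)) = (\<Prod>e\<in>F. Abs_fps (f e))"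
  using assms
proof (induction F rule: finite_induct)
  case empty
  have "tuples ({} :: 'a set set) n = (if n = 0 then {\<lambda>_. 0} else {})" for n
    by (auto simp: tuples_def)
  then show ?case
    by (simp add: fps_eq_iff)
next
  case (insert e F)
  have "(\<Sum>\<nu>\<in>tuples (insert e F) n. \<Prod>x\<in>insert e F. f x (\<nu> x)) =
      (Abs_fps (f e) * Abs_fps (\<lambda>n. \<Sum>\<nu>\<in>tuples F n. \<Prod>x\<in>F. f x (\<nu> x))) $ n" for n
  proof -
    have "(\<Prod>x\<in>insert e F. f x ((\<nu>(e := i)) x)) = f e i * (\<Prod>x\<in>F. f x (\<nu> x))" for i \<nu>
    proof -
      have "(\<Prod>x\<in>F. f x ((\<nu>(e := i)) x)) = (\<Prod>x\<in>F. f x (\<nu> x))"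
        using insert.hyps by (intro prod.cong) auto
      then show ?thesis
        using insert.hyps by simp
    qed
    then show ?thesis
      by (simp only: sum_tuples_insert[OF insert.hyps] fps_mult_nth fps_nth_Abs_fps sum_distrib_left)
  qed
  then show ?case
    using insert by (simp add: fps_eq_iff)
qed

lemma rational_family_subdivision_family:
  fixes G :: "'a graph"
  assumes "simple_graph G" "F \<subseteq> edges G"
  shows "rational_family (subdivision_family G F)"
proof -
  let ?V = "verts G" and ?E = "edges G"
  have finE: "finite ?E" and finF: "finite F"
    using assms finite_edges finite_subset by auto
  note ends = endpoints_edge[OF assms(1)]
  define z where "z = (\<lambda>(g :: 'a \<Rightarrow> nat) pq e k. path_sum edge_weight {0, 1} k
      (g (fst (endpoints e))) (g (snd (endpoints e))) (pq e))"
  have bw: "bw_poly (subdivide G \<nu>) =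
      (\<Sum>g\<in>?V \<rightarrow>\<^sub>E {0, 1}. \<Sum>pq\<in>?E \<rightarrow>\<^sub>E ({0, 1} \<times> {0, 1}).
        branch_weight G g pq * (\<Prod>e\<in>?E. z g pq e (\<nu> e)))" for \<nu>
    unfolding bw_poly_subdivide[OF assms(1)]
  proof (rule sum.cong[OF refl])
    fix g :: "'a \<Rightarrow> nat" assume g: "g \<in> ?V \<rightarrow>\<^sub>E {0, 1}"
    let ?ext = "\<lambda>e. extend_path (g (fst (endpoints e))) (g (snd (endpoints e))) (\<nu> e)"
    have gi: "g (fst (endpoints e)) \<in> {0, 1}" "g (snd (endpoints e)) \<in> {0, 1}" if "e \<in> ?E" for e
      using PiE_mem[OF g] ends(3,4)[OF that] by blast+
    show "(\<Sum>y\<in>PiE ?E (\<lambda>e. {1..\<nu> e} \<rightarrow>\<^sub>E {0, 1}).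
        branch_weight G g (\<lambda>e\<in>?E. (?ext e (y e) 1, ?ext e (y e) (\<nu> e))) *
        (\<Prod>e\<in>?E. path_weight edge_weight (\<nu> e) (?ext e (y e)))) =
      (\<Sum>pq\<in>?E \<rightarrow>\<^sub>E ({0, 1} \<times> {0, 1}). branch_weight G g pq * (\<Prod>e\<in>?E. z g pq e (\<nu> e)))"
      unfolding z_def path_sum_def
    proof (rule sum_PiE_group[OF finE, where h = "\<lambda>e y. (?ext e y 1, ?ext e y (\<nu> e))"
          and f = "\<lambda>e y. path_weight edge_weight (\<nu> e) (?ext e y)"])
      fix e assume "e \<in> ?E"
      note gi = gi[OF this]
      have "?ext e y i \<in> {0, 1}" if "y \<in> {1..\<nu> e} \<rightarrow>\<^sub>E {0, 1}" for y i
        using gi PiE_mem[OF that, of i] by (simp add: extend_path_def)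
      then show "(\<lambda>y. (?ext e y 1, ?ext e y (\<nu> e))) ` ({1..\<nu> e} \<rightarrow>\<^sub>E {0, 1}) \<subseteq> {0, 1} \<times> {0, 1}"
        by blast
    qed (simp_all add: finite_PiE)
  qed
  \<comment> \<open>Edges outside \<open>F\<close> have length 0 and contribute a factor common to
    all tuples.\<close>
  have split: "(\<Prod>e\<in>?E. z g pq e (\<nu> e)) = (\<Prod>e\<in>?E - F. z g pq e 0) * (\<Prod>e\<in>F. z g pq e (\<nu> e))"
    if "\<nu> \<in> tuples F n" for g pq \<nu> n
  proof -
    have "(\<Prod>e\<in>?E - F. z g pq e (\<nu> e)) = (\<Prod>e\<in>?E - F. z g pq e 0)"
      using that by (intro prod.cong) (auto simp: tuples_def)
    then show ?thesis
      using prod.subset_diff[OF assms(2) finE, of "\<lambda>e. z g pq e (\<nu> e)"] by simp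
  qed
  have "gen_fun (subdivision_family G F) = Abs_fps (\<lambda>n.
      \<Sum>g\<in>?V \<rightarrow>\<^sub>E {0, 1}. \<Sum>pq\<in>?E \<rightarrow>\<^sub>E ({0, 1} \<times> {0, 1}).
        (branch_weight G g pq * (\<Prod>e\<in>?E - F. z g pq e 0)) *
        (\<Sum>\<nu>\<in>tuples F n. \<Prod>e\<in>F. z g pq e (\<nu> e)))"
  proof (rule fps_ext)
    fix n
    have "gen_fun (subdivision_family G F) $ n = (\<Sum>\<nu>\<in>tuples F n. bw_poly (subdivide G \<nu>))"
      by (simp add: gen_fun_def subdivision_family_def image_mset.compositionality comp_def sum_unfold_sum_mset)
    also have "\<dots> = (\<Sum>\<nu>\<in>tuples F n. \<Sum>g\<in>?V \<rightarrow>\<^sub>E {0, 1}. \<Sum>pq\<in>?E \<rightarrow>\<^sub>E ({0, 1} \<times> {0, 1}).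
        (branch_weight G g pq * (\<Prod>e\<in>?E - F. z g pq e 0)) * (\<Prod>e\<in>F. z g pq e (\<nu> e)))"
      unfolding bw by (intro sum.cong refl) (simp only: split mult.assoc)
    \<comment> \<open>The swap is possible because the boundary pairs, unlike the colorings of the
      chains, range over a set independent of \<open>\<nu>\<close>.\<close>
    also have "\<dots> = (\<Sum>g\<in>?V \<rightarrow>\<^sub>E {0, 1}. \<Sum>pq\<in>?E \<rightarrow>\<^sub>E ({0, 1} \<times> {0, 1}). \<Sum>\<nu>\<in>tuples F n.
        (branch_weight G g pq * (\<Prod>e\<in>?E - F. z g pq e 0)) * (\<Prod>e\<in>F. z g pq e (\<nu> e)))"
      by (subst sum.swap, intro sum.cong refl, rule sum.swap)
    finally show "gen_fun (subdivision_family G F) $ n = Abs_fps (\<lambda>n.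
        \<Sum>g\<in>?V \<rightarrow>\<^sub>E {0, 1}. \<Sum>pq\<in>?E \<rightarrow>\<^sub>E ({0, 1} \<times> {0, 1}).
          (branch_weight G g pq * (\<Prod>e\<in>?E - F. z g pq e 0)) *
          (\<Sum>\<nu>\<in>tuples F n. \<Prod>e\<in>F. z g pq e (\<nu> e))) $ n"
      by (simp add: sum_distrib_left)
  qed
  moreover have "rational_fps \<dots>"
  proof (intro rational_fps_Abs_fps_sum rational_fps_Abs_fps_mult_left)
    fix g :: "'a \<Rightarrow> nat" and pq :: "'a set \<Rightarrow> nat \<times> nat"
    assume g: "g \<in> ?V \<rightarrow>\<^sub>E {0, 1}" and pq: "pq \<in> ?E \<rightarrow>\<^sub>E ({0, 1} \<times> {0, 1})"
    show "rational_fps (Abs_fps (\<lambda>n. \<Sum>\<nu>\<in>tuples F n. \<Prod>e\<in>F. z g pq e (\<nu> e)))"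
      unfolding Abs_fps_sum_tuples[OF finF]
    proof (rule rational_fps_prod)
      fix e assume "e \<in> F"
      then have e: "e \<in> ?E"
        using assms(2) by blast
      obtain p q where "pq e = (p, q)" "q \<in> {0, 1}"
        using PiE_mem[OF pq e] by blast
      moreover have "g (fst (endpoints e)) \<in> {0, 1}" "g (snd (endpoints e)) \<in> {0, 1}"
        using PiE_mem[OF g] ends(3,4)[OF e] by blast+
      ultimately show "rational_fps (Abs_fps (z g pq e))"
        using rational_fps_path_sum[of "{0, 1}" "g (fst (endpoints e))" "g (snd (endpoints e))" q
            edge_weight p]
        by (simp add: z_def)
    qed
  qed
  ultimately show ?thesis
    by (simp add: rational_family_def rational_fps_def)
qed

text \<open>Only one tuple with sum \<open>n\<close> is supported on a single edge, so subdividing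
  one edge is a special case of subdividing a set.\<close>

lemma subdivision_family_singleton:
  "subdivision_family G {e} = family_from 0 (subdivide_edge G e)"
proof
  fix n
  have "tuples {e} n = {\<lambda>e'. if e' = e then n else 0}"
    by (auto simp: tuples_def fun_eq_iff split: if_splits)
  then show "subdivision_family G {e} n = family_from 0 (subdivide_edge G e) n"
    by (simp add: subdivision_family_def family_from_def subdivide_edge_def)
qed

section \<open>Rationality of the six families\<close>

theorem theorem2p3:
  fixes G :: "'a graph"
  assumes "simple_graph G"
  shows
    "rational_family (family_from 1 (\<lambda>n. box_product G (path_graph n))) \<and>
     (\<forall>H. subgraph H G \<longrightarrow> rational_family (family_from 1 (extrusion G H))) \<and>
     rational_family (family_from 3 (\<lambda>n. box_product G (cycle_graph n))) \<and>
     (\<forall>H. subgraph H G \<longrightarrow> rational_family (family_from 3 (earring G H))) \<and>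
     (\<forall>e \<in> edges G. rational_family (family_from 0 (subdivide_edge G e))) \<and>
     (\<forall>F \<subseteq> edges G. rational_family (subdivision_family G F))"
proof (intro conjI allI ballI impI)
  have sub: "subgraph G G"
    using assms by (simp add: subgraph_def)
  show "rational_family (family_from 1 (\<lambda>n. box_product G (path_graph n)))"
  proof (rule rational_family_glued(1)[OF assms sub])
    fix n :: nat assume "n \<ge> 1"
    then show "bw_poly (box_product G (path_graph n)) = bw_poly (glued G G (path_graph n))"
      by (intro bw_poly_box_product[OF assms, of _ "n - 1"] simple_graph_path_graph)
        (simp add: path_graph_def)
  qed
  show "rational_family (family_from 3 (\<lambda>n. box_product G (cycle_graph n)))"
  proof (rule rational_family_glued(2)[OF assms sub])
    fix n :: nat assume "n \<ge> 3"
    then show "bw_poly (box_product G (cycle_graph n)) = bw_poly (glued G G (cycle_graph n))"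
      by (intro bw_poly_box_product[OF assms, of _ "n - 1"] simple_graph_cycle_graph)
        (simp_all add: cycle_graph_def)
  qed
  show "rational_family (family_from 1 (extrusion G H))" if "subgraph H G" for H
    by (rule rational_family_glued(1)[OF assms that]) (simp add: extrusion_def glued_def)
  show "rational_family (family_from 3 (earring G H))" if "subgraph H G" for H
    by (rule rational_family_glued(2)[OF assms that]) (simp add: earring_def glued_def)
  show "rational_family (family_from 0 (subdivide_edge G e))" if "e \<in> edges G" for e
    using rational_family_subdivision_family[OF assms, of "{e}"] that
    by (simp add: subdivision_family_singleton)
  show "rational_family (subdivision_family G F)" if "F \<subseteq> edges G" for F
    by (rule rational_family_subdivision_family[OF assms that])
qed

end
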